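(* Let $C$ be a commutative unital ring and let $\mathfrak{G}$ be the generalized Grassmann algebra over $C$. Then $\operatorname{id}(\mathfrak{G})$ is generated as a T-ideal by the Grassmann identity $[x,[y,z]]=0$.
   Context: Algebras are associative, not necessarily unital; $[a,b]=ab-ba$. $C\langle X\rangle$ is the free associative $C$-algebra on a countably infinite alphabet $X$. For a $C$-algebra $A$, $\operatorname{id}(A)\subseteq C\langle X\rangle$ is the set of all $f(x_1,\dots,x_n)\in C\langle X\rangle$ such that $f(a_1,\dots,a_n)=0$ for all $a_1,\dots,a_n\in A$. A T-ideal is a two-sided ideal of $C\langle X\rangle$ stable under all endomorphisms of $C\langle X\rangle$; the T-ideal generated by $[x,[y,z]]$ (with $x,y,z$ distinct letters of $X$) is the smallest T-ideal containing it. $C[\varepsilon]$ denotes the commutative unital $C$-algebra $C[\theta,\varepsilon_1,\varepsilon_2,\dots]$ subject to the relations $\theta^2=2$ and $\varepsilon_i^2=\theta\varepsilon_i$ for all $i$. The generalized Grassmann algebra $\mathfrak{G}$ over $C$ is the unital algebra generated by $e_1,e_2,\dots$ over the central subring $C[\varepsilon]$, subject to the relations $[e_i,e_j]=\varepsilon_i\varepsilon_j e_ie_j$ for all $i,j$ (including $i=j$, which gives $\theta\varepsilon_i e_i^2=\varepsilon_i^2e_i^2=0$). *)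

theory Defs
  imports Complex_Main "HOL-Library.Poly_Mapping"
begin

section \<open>Associative algebras, ideals and homomorphisms\<close>

text \<open>Algebras are associative but not necessarily unital, hence the class \<open>ring\<close>.\<close>

locale assoc_algebra = module scale
  for scale :: "'c::comm_ring_1 \<Rightarrow> 'a::ring \<Rightarrow> 'a" +
  assumes scale_mult_left: "scale c (x * y) = scale c x * y"
    and scale_mult_right: "scale c (x * y) = x * scale c y"

definition commutator :: "'a::ring \<Rightarrow> 'a \<Rightarrow> 'a" where
  "commutator a b = a * b - b * a"

text \<open>
  Ideals of an algebra are submodules. The ideal generated by a set \<open>S\<close>, that is the smallest
  ideal containing \<open>S\<close>, is \<open>two_sided_ideal scale hull S\<close>.
\<close>

definition two_sided_ideal :: "('c::comm_ring_1 \<Rightarrow> 'a::ring \<Rightarrow> 'a) \<Rightarrow> 'a set \<Rightarrow> bool" where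
  "two_sided_ideal scale I \<longleftrightarrow>
     module.subspace scale I \<and> (\<forall>x\<in>I. \<forall>a. a * x \<in> I \<and> x * a \<in> I)"

definition algebra_hom ::
  "('c::comm_ring_1 \<Rightarrow> 'a::ring \<Rightarrow> 'a) \<Rightarrow> ('c \<Rightarrow> 'b::ring \<Rightarrow> 'b) \<Rightarrow> ('a \<Rightarrow> 'b) \<Rightarrow> bool" where
  "algebra_hom scaleA scaleB \<phi> \<longleftrightarrow>
     module_hom scaleA scaleB \<phi> \<and> (\<forall>x y. \<phi> (x * y) = \<phi> x * \<phi> y)"

lemma two_sided_idealI:
  assumes "module scale" "0 \<in> I" "\<And>x y. x \<in> I \<Longrightarrow> y \<in> I \<Longrightarrow> x + y \<in> I"
    "\<And>c x. x \<in> I \<Longrightarrow> scale c x \<in> I" "\<And>a x. x \<in> I \<Longrightarrow> a * x \<in> I" "\<And>a x. x \<in> I \<Longrightarrow> x * a \<in> I"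
  shows "two_sided_ideal scale I"
  using assms by (auto simp: two_sided_ideal_def module.subspace_def)

lemma two_sided_ideal_hull:
  assumes "module scale"
  shows "two_sided_ideal scale (two_sided_ideal scale hull S)"
  by (rule hull_in) (auto simp: two_sided_ideal_def module.subspace_def[OF assms])

lemma two_sided_idealD:
  assumes "module scale" "two_sided_ideal scale I"
  shows "0 \<in> I" "x \<in> I \<Longrightarrow> y \<in> I \<Longrightarrow> x + y \<in> I" "x \<in> I \<Longrightarrow> y \<in> I \<Longrightarrow> x - y \<in> I"
    "x \<in> I \<Longrightarrow> - x \<in> I" "x \<in> I \<Longrightarrow> scale c x \<in> I" "x \<in> I \<Longrightarrow> a * x \<in> I" "x \<in> I \<Longrightarrow> x * a \<in> I"
  using assms(2) module.subspace_diff[OF assms(1)] module.subspace_neg[OF assms(1)]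
  by (auto simp: two_sided_ideal_def module.subspace_def[OF assms(1)])

lemma ideal_congruence_equivp:
  assumes "module scale" "two_sided_ideal scale I"
  shows "equivp (\<lambda>p q. p - q \<in> I)"
proof (intro equivpI reflpI sympI transpI)
  note D = two_sided_idealD[OF assms]
  show "x - x \<in> I" for x by (simp add: D)
  show "y - x \<in> I" if "x - y \<in> I" for x y using D(4)[OF that] by simp
  show "x - z \<in> I" if "x - y \<in> I" "y - z \<in> I" for x y z using D(2)[OF that] by simp
qed

lemma ideal_congruence_ops:
  assumes "module scale" "two_sided_ideal scale I"
  assumes "p - p' \<in> I" "q - q' \<in> I"
  shows "(p + q) - (p' + q') \<in> I" "(p - q) - (p' - q') \<in> I" "- p - (- p') \<in> I"
    "p * q - p' * q' \<in> I" "scale c p - scale c p' \<in> I"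
proof -
  note D = two_sided_idealD[OF assms(1,2)]
  have "p * q - p' * q' = (p - p') * q + p' * (q - q')"
    by (simp add: algebra_simps)
  thus "p * q - p' * q' \<in> I"
    using assms(3,4) by (auto intro: D)
  have "scale c p - scale c p' = scale c (p - p')"
    using module.scale_right_diff_distrib[OF assms(1)] by simp
  thus "scale c p - scale c p' \<in> I"
    using assms(3) by (auto intro: D)
  show "(p + q) - (p' + q') \<in> I"
    using D(2)[OF assms(3,4)] by (simp add: algebra_simps)
  show "(p - q) - (p' - q') \<in> I"
    using D(3)[OF assms(3,4)] by (simp add: algebra_simps)
  show "- p - (- p') \<in> I"
    using D(4)[OF assms(3)] by simp
qed


section \<open>Monoid algebras\<close>

text \<open>
  For a monoid \<open>'k\<close> (written additively, as the library requires) the type \<open>'k \<Rightarrow>\<^sub>0 'c\<close> with its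
  convolution product is the monoid algebra of \<open>'k\<close> over \<open>'c\<close>. For \<open>'k = 'x \<Rightarrow>\<^sub>0 nat\<close> this is the
  polynomial algebra in the variables \<open>'x\<close>, and for the free monoid \<open>'k = 'x word\<close> it is the free
  unital associative algebra on \<open>'x\<close>.
\<close>

abbreviation lookup where "lookup \<equiv> Poly_Mapping.lookup"
abbreviation single where "single \<equiv> Poly_Mapping.single"
abbreviation keys where "keys \<equiv> Poly_Mapping.keys"

definition smult :: "'c::comm_ring_1 \<Rightarrow> ('k \<Rightarrow>\<^sub>0 'c) \<Rightarrow> ('k \<Rightarrow>\<^sub>0 'c)" where
  "smult c = Poly_Mapping.map ((*) c)"

lemma lookup_smult: "lookup (smult c f) k = c * lookup f k"
  unfolding smult_def by transfer (simp add: when_def)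

lemma module_smult: "module smult"
  by standard (auto intro!: poly_mapping_eqI simp: lookup_smult lookup_add algebra_simps)

lemma smult_conv_mult: "smult c f = single 0 c * f"
  by (simp add: smult_def mult_map_scale_conv_mult)

interpretation monoid_algebra:
  assoc_algebra "smult :: 'c \<Rightarrow> ('k::monoid_add \<Rightarrow>\<^sub>0 'c) \<Rightarrow> ('k \<Rightarrow>\<^sub>0 'c::comm_ring_1)"
proof (intro assoc_algebra.intro module_smult assoc_algebra_axioms.intro)
  have comm: "single 0 c * f = f * single 0 c" for c :: 'c and f :: "'k \<Rightarrow>\<^sub>0 'c"
  proof (rule poly_mapping_eqI)
    fix k
    have "(lookup (single 0 c) q when k = l + q) = ((c when k = l) when q = 0)" for l q :: 'k
      by (auto simp: lookup_single when_def)
    hence "lookup (f * single 0 c) k = (\<Sum>l. lookup f l * (c when k = l))"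
      by (simp add: lookup_mult)
    also have "\<dots> = (\<Sum>l. lookup f l * c when l = k)"
      by (rule Sum_any.cong) (auto simp: when_def)
    finally show "lookup (single 0 c * f) k = lookup (f * single 0 c) k"
      by (simp add: lookup_smult mult.commute flip: smult_conv_mult)
  qed
  fix c :: 'c and x y :: "'k \<Rightarrow>\<^sub>0 'c"
  show "smult c (x * y) = smult c x * y"
    by (simp add: smult_conv_mult mult.assoc)
  show "smult c (x * y) = x * smult c y"
    by (simp add: smult_conv_mult mult.assoc flip: comm[of c y])
      (simp add: comm[of c x] flip: mult.assoc)
qed

datatype 'x word = Word (letters: "'x list")

instantiation word :: (type) monoid_add
begin
definition zero_word :: "'a word" where "0 = Word []"
definition plus_word :: "'a word \<Rightarrow> 'a word \<Rightarrow> 'a word" where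
  "u + v = Word (letters u @ letters v)"
instance by standard (simp_all add: zero_word_def plus_word_def)
end

lemma word_add_eq_0_iff: "0 = u + v \<longleftrightarrow> u = 0 \<and> v = (0 :: 'x word)"
  by (cases u; cases v) (auto simp: zero_word_def plus_word_def)

lemma lookup_mult_empty_word:
  "lookup (f * g) (0 :: 'x word) = lookup f 0 * (lookup g 0 :: 'c::comm_ring_1)"
proof -
  have "(lookup g q when 0 = l + q) = ((lookup g q when q = 0) when l = 0)" for l q :: "'x word"
    by (auto simp: word_add_eq_0_iff when_def)
  hence "(\<Sum>q. lookup g q when 0 = l + q) = (lookup g 0 when l = 0)" for l :: "'x word"
    by (cases "l = 0") simp_all
  thus ?thesis by (simp add: lookup_mult mult_when)
qed


section \<open>The free associative algebra and polynomial identities\<close>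

text \<open>
  As algebras need not have a unit, the free algebra on the letters \<open>X = {x\<^sub>0, x\<^sub>1, \<dots>}\<close>
  consists of the noncommutative polynomials without constant term.
\<close>

typedef (overloaded) 'c free_algebra = "{f :: nat word \<Rightarrow>\<^sub>0 'c::comm_ring_1. lookup f 0 = 0}"
  morphisms ncpoly Abs_free_algebra
  by (rule exI[of _ 0]) simp

setup_lifting type_definition_free_algebra

instantiation free_algebra :: (comm_ring_1) ring
begin
lift_definition zero_free_algebra :: "'a free_algebra" is 0 by simp
lift_definition plus_free_algebra :: "'a free_algebra \<Rightarrow> 'a free_algebra \<Rightarrow> 'a free_algebra"
  is "(+)" by (simp add: lookup_add)
lift_definition minus_free_algebra :: "'a free_algebra \<Rightarrow> 'a free_algebra \<Rightarrow> 'a free_algebra"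
  is "(-)" by (simp add: lookup_minus)
lift_definition uminus_free_algebra :: "'a free_algebra \<Rightarrow> 'a free_algebra"
  is uminus by simp
lift_definition times_free_algebra :: "'a free_algebra \<Rightarrow> 'a free_algebra \<Rightarrow> 'a free_algebra"
  is "(*)" by (simp add: lookup_mult_empty_word)
instance by standard (transfer, simp add: algebra_simps)+
end

lift_definition fsmult :: "'c::comm_ring_1 \<Rightarrow> 'c free_algebra \<Rightarrow> 'c free_algebra" is smult
  by (simp add: lookup_smult)

interpretation free_algebra: assoc_algebra "fsmult :: 'c::comm_ring_1 \<Rightarrow> 'c free_algebra \<Rightarrow> _"
  by standard
    (transfer, simp add: algebra_simps monoid_algebra.scale_mult_left
      flip: monoid_algebra.scale_mult_right)+

lift_definition letter :: "nat \<Rightarrow> 'c::comm_ring_1 free_algebra" is "\<lambda>n. single (Word [n]) 1"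
  by (simp add: lookup_single zero_word_def)

text \<open>
  The product of a nonempty list. It is left unspecified for the empty list, as the target algebras
  need not have a unit; elements of the free algebra do not involve the empty word.
\<close>

fun nonempty_prod :: "'a::times list \<Rightarrow> 'a" where
  "nonempty_prod [x] = x"
| "nonempty_prod (x # y # xs) = x * nonempty_prod (y # xs)"

definition evaluate ::
  "('c::comm_ring_1 \<Rightarrow> 'a::ring \<Rightarrow> 'a) \<Rightarrow> (nat \<Rightarrow> 'a) \<Rightarrow> 'c free_algebra \<Rightarrow> 'a" where
  "evaluate scale a f =
     (\<Sum>w \<in> keys (ncpoly f). scale (lookup (ncpoly f) w) (nonempty_prod (map a (letters w))))"

definition identities :: "('c::comm_ring_1 \<Rightarrow> 'a::ring \<Rightarrow> 'a) \<Rightarrow> 'c free_algebra set" where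
  "identities scale = {f. \<forall>a. evaluate scale a f = 0}"

text \<open>The T-ideal generated by \<open>S\<close> is \<open>T_ideal hull S\<close>.\<close>

definition T_ideal :: "'c::comm_ring_1 free_algebra set \<Rightarrow> bool" where
  "T_ideal I \<longleftrightarrow> two_sided_ideal fsmult I \<and> (\<forall>\<phi>. algebra_hom fsmult fsmult \<phi> \<longrightarrow> \<phi> ` I \<subseteq> I)"

lemma T_ideal_hull: "T_ideal (T_ideal hull S)"
proof (rule hull_in)
  fix \<T> :: "'a free_algebra set set" assume T: "Ball \<T> T_ideal"
  show "T_ideal (\<Inter>\<T>)"
    using T unfolding T_ideal_def two_sided_ideal_def free_algebra.subspace_def
    by (auto 4 4 simp: image_subset_iff)
qed

lemma evaluate_letter:
  assumes "module scale" shows "evaluate scale a (letter n) = a n"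
  using module.scale_one[OF assms] by (simp add: evaluate_def letter.rep_eq)


section \<open>The coefficient ring \<open>C[\<epsilon>]\<close>\<close>

datatype eps_var = Theta | Eps nat

type_synonym 'c eps_poly = "(eps_var \<Rightarrow>\<^sub>0 nat) \<Rightarrow>\<^sub>0 'c"

definition pvar :: "eps_var \<Rightarrow> 'c::comm_ring_1 eps_poly" where
  "pvar v = single (single v 1) 1"

definition eps_relations :: "'c::comm_ring_1 eps_poly set" where
  "eps_relations = insert (pvar Theta ^ 2 - 2)
     (range (\<lambda>i. pvar (Eps i) ^ 2 - pvar Theta * pvar (Eps i)))"

definition eps_ideal :: "'c::comm_ring_1 eps_poly set" where
  "eps_ideal = two_sided_ideal smult hull eps_relations"

lemma two_sided_ideal_eps_ideal: "two_sided_ideal smult eps_ideal"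
  unfolding eps_ideal_def by (rule two_sided_ideal_hull[OF module_smult])

lemmas eps_ops = ideal_congruence_ops[OF module_smult two_sided_ideal_eps_ideal]

text \<open>
  To see that \<open>1\<close> is not in the ideal, consider the linear functional that is \<open>2 ^ k\<close> on
  \<open>\<theta> ^ (2 * k)\<close> and zero on all other monomials.
\<close>

definition eps_functional_mon :: "(eps_var \<Rightarrow>\<^sub>0 nat) \<Rightarrow> 'c::comm_ring_1" where
  "eps_functional_mon m =
     (if keys m \<subseteq> {Theta} \<and> even (lookup m Theta) then 2 ^ (lookup m Theta div 2) else 0)"

definition eps_functional :: "'c::comm_ring_1 eps_poly \<Rightarrow> 'c" where
  "eps_functional p = (\<Sum>m. lookup p m * eps_functional_mon m)"

lemma eps_functional_add: "eps_functional (p + q) = eps_functional p + eps_functional q"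
proof -
  have "finite {m. lookup r m * eps_functional_mon m \<noteq> 0}" for r :: "'a eps_poly"
    by (rule finite_subset[OF _ finite_lookup[of r]]) auto
  thus ?thesis
    unfolding eps_functional_def by (simp add: lookup_add distrib_right Sum_any.distrib)
qed

lemma eps_functional_0: "eps_functional 0 = 0"
  by (simp add: eps_functional_def)

lemma eps_functional_diff: "eps_functional (p - q) = eps_functional p - eps_functional q"
  using eps_functional_add[of "p - q" q] by simp

lemma eps_functional_single: "eps_functional (single m c) = c * eps_functional_mon m"
proof -
  have "lookup (single m c) k * eps_functional_mon k = (c * eps_functional_mon k when k = m)" for k
    by (auto simp: lookup_single when_def)
  thus ?thesis by (simp add: eps_functional_def)
qed

lemma eps_functional_relation:
  fixes q :: "'c::comm_ring_1 eps_poly"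
  assumes "r \<in> eps_relations"
  shows "eps_functional (q * r) = 0"
proof (induction q rule: update_induct)
  case const
  show ?case by (simp add: eps_functional_0)
next
  case (update f m c)
  have upd: "Poly_Mapping.update m c f = single m c + f"
    using update(1)
    by (intro poly_mapping_eqI)
      (auto simp: lookup_update lookup_add lookup_single when_def in_keys_iff)
  have keys: "keys (m + single v k) = insert v (keys m)" if "k > 0" for m v and k :: nat
    using that by (auto simp: in_keys_iff lookup_add lookup_single when_def split: if_splits)
  have "eps_functional (single m c * r) = 0"
    using assms unfolding eps_relations_def
  proof (elim insertE imageE)
    assume r: "r = pvar Theta ^ 2 - 2"
    have "single m c * r = single (m + single Theta 2) c - single m (2 * c)"
    proof -
      have "single m c * (2 :: 'c eps_poly) = single m (2 * c)"
        by (simp add: mult_single mult.commute flip: single_numeral)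
      thus ?thesis
        by (simp add: r pvar_def power2_eq_square right_diff_distrib mult_single numeral_2_eq_2
            flip: single_add)
    qed
    thus ?thesis
      by (auto simp: eps_functional_diff eps_functional_single eps_functional_mon_def keys
          lookup_add)
  next
    fix i assume r: "r = pvar (Eps i) ^ 2 - pvar Theta * pvar (Eps i)"
    have "single m c * r =
        single (m + single (Eps i) 2) c - single (m + single Theta 1 + single (Eps i) 1) c"
      by (simp add: r pvar_def power2_eq_square right_diff_distrib mult_single numeral_2_eq_2
          add.assoc flip: single_add)
    moreover have "eps_functional_mon (m + single (Eps i) 2) = (0 :: 'c)"
      "eps_functional_mon (m + single Theta 1 + single (Eps i) 1) = (0 :: 'c)"
      unfolding eps_functional_mon_def by (subst keys; simp)+
    ultimately show ?thesis
      by (simp only: eps_functional_diff eps_functional_single) simp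
  qed
  with update(3) show ?case
    by (simp add: upd distrib_right eps_functional_add)
qed

lemma one_notin_eps_ideal: "(1 :: 'c::comm_ring_1 eps_poly) \<notin> eps_ideal"
proof
  let ?J = "{p :: 'c eps_poly. \<forall>q. eps_functional (q * p) = 0}"
  have "two_sided_ideal smult ?J"
  proof (rule two_sided_idealI[OF module_smult])
    fix c and a p :: "'c eps_poly" assume p: "p \<in> ?J"
    have left: "a * p \<in> ?J" for a
      using p by (simp flip: mult.assoc)
    show "a * p \<in> ?J" "smult c p \<in> ?J"
      using left by (simp_all only: smult_conv_mult)
    show "p * a \<in> ?J"
      using left[of a] by (simp only: mult.commute)
  qed (auto simp: eps_functional_0 distrib_left eps_functional_add)
  hence "eps_ideal \<subseteq> ?J"
    unfolding eps_ideal_def by (intro hull_minimal) (auto simp: eps_functional_relation)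
  moreover assume "(1 :: 'c eps_poly) \<in> eps_ideal"
  ultimately have "eps_functional (1 * 1 :: 'c eps_poly) = 0"
    by blast
  moreover have "eps_functional (1 :: 'c eps_poly) = 1"
    using eps_functional_single[of 0 "1 :: 'c"] by (simp add: eps_functional_mon_def)
  ultimately show False by simp
qed

quotient_type (overloaded) 'c eps_ring =
  "'c::comm_ring_1 eps_poly" / "\<lambda>p q. p - q \<in> eps_ideal"
  by (rule ideal_congruence_equivp[OF module_smult two_sided_ideal_eps_ideal])

instantiation eps_ring :: (comm_ring_1) comm_ring_1
begin
lift_definition zero_eps_ring :: "'a eps_ring" is 0 .
lift_definition one_eps_ring :: "'a eps_ring" is 1 .
lift_definition plus_eps_ring :: "'a eps_ring \<Rightarrow> 'a eps_ring \<Rightarrow> 'a eps_ring"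
  is "(+)" by (rule eps_ops)
lift_definition minus_eps_ring :: "'a eps_ring \<Rightarrow> 'a eps_ring \<Rightarrow> 'a eps_ring"
  is "(-)" by (rule eps_ops)
lift_definition uminus_eps_ring :: "'a eps_ring \<Rightarrow> 'a eps_ring"
  is uminus by (rule eps_ops)
lift_definition times_eps_ring :: "'a eps_ring \<Rightarrow> 'a eps_ring \<Rightarrow> 'a eps_ring"
  is "(*)" by (rule eps_ops)
instance
proof
  show "(0 :: 'a eps_ring) \<noteq> 1"
  proof transfer
    show "0 - 1 \<notin> (eps_ideal :: 'a eps_poly set)"
      using one_notin_eps_ideal
        two_sided_idealD(4)[OF module_smult two_sided_ideal_eps_ideal, of "0 - 1 :: 'a eps_poly"]
      by auto
  qed
qed (transfer, simp add: algebra_simps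
    two_sided_idealD(1)[OF module_smult two_sided_ideal_eps_ideal])+
end

lift_definition eps_const :: "'c::comm_ring_1 \<Rightarrow> 'c eps_ring" is "single 0" .

lift_definition theta :: "'c::comm_ring_1 eps_ring" is "pvar Theta" .

lift_definition eps :: "nat \<Rightarrow> 'c::comm_ring_1 eps_ring" is "\<lambda>i. pvar (Eps i)" .


lemma theta_square: "(theta :: 'c::comm_ring_1 eps_ring) ^ 2 = 2"
proof -
  have "pvar Theta * pvar Theta - (1 + 1) \<in> (eps_ideal :: 'c eps_poly set)"
    using hull_subset[of eps_relations "two_sided_ideal smult"]
    by (auto simp: eps_ideal_def eps_relations_def power2_eq_square)
  hence "theta * theta = (1 + 1 :: 'c eps_ring)"
    by transfer
  thus ?thesis by (simp add: power2_eq_square)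
qed

lemma eps_square: "(eps i :: 'c::comm_ring_1 eps_ring) ^ 2 = theta * eps i"
proof -
  have "pvar (Eps i) * pvar (Eps i) - pvar Theta * pvar (Eps i) \<in> (eps_ideal :: 'c eps_poly set)"
    using hull_subset[of eps_relations "two_sided_ideal smult"]
    by (auto simp: eps_ideal_def eps_relations_def power2_eq_square)
  hence "eps i * eps i = (theta * eps i :: 'c eps_ring)"
    by transfer
  thus ?thesis by (simp add: power2_eq_square)
qed

lemma eps_const_hom:
  "eps_const (c + d) = eps_const c + eps_const d" "eps_const (c * d) = eps_const c * eps_const d"
  "eps_const 1 = 1"
  by (transfer, simp add: single_add mult_single
      two_sided_idealD(1)[OF module_smult two_sided_ideal_eps_ideal])+

lifting_forget eps_ring.lifting


section \<open>The generalized Grassmann algebra\<close>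

text \<open>
  Over the commutative ring \<open>C[\<epsilon>]\<close>, the free unital algebra on \<open>e\<^sub>0, e\<^sub>1, \<dots>\<close> modulo the two-sided
  ideal of the relations; the coefficients \<open>C[\<epsilon>]\<close> are then central by construction.
\<close>

type_synonym 'c gr_poly = "nat word \<Rightarrow>\<^sub>0 'c eps_ring"

definition gvar :: "nat \<Rightarrow> 'c::comm_ring_1 gr_poly" where
  "gvar i = single (Word [i]) 1"

definition grassmann_relations :: "'c::comm_ring_1 gr_poly set" where
  "grassmann_relations =
     {commutator (gvar i) (gvar j) - smult (eps i * eps j) (gvar i * gvar j) | i j. True}"

definition grassmann_ideal :: "'c::comm_ring_1 gr_poly set" where
  "grassmann_ideal = two_sided_ideal smult hull grassmann_relations"

lemma two_sided_ideal_grassmann_ideal: "two_sided_ideal smult grassmann_ideal"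
  unfolding grassmann_ideal_def by (rule two_sided_ideal_hull[OF module_smult])

lemmas grassmann_ops = ideal_congruence_ops[OF module_smult two_sided_ideal_grassmann_ideal]

lemma one_notin_grassmann_ideal: "(1 :: 'c::comm_ring_1 gr_poly) \<notin> grassmann_ideal"
proof
  let ?J = "{p :: 'c gr_poly. lookup p 0 = 0}"
  have "two_sided_ideal smult ?J"
    by (rule two_sided_idealI[OF module_smult])
      (auto simp: lookup_add lookup_smult lookup_mult_empty_word)
  moreover have "grassmann_relations \<subseteq> ?J"
  proof -
    have "lookup (gvar i * gvar j :: 'c gr_poly) 0 = 0" for i j
      unfolding lookup_mult_empty_word by (simp add: gvar_def lookup_single zero_word_def)
    thus ?thesis
      by (auto simp: grassmann_relations_def commutator_def lookup_minus lookup_smult)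
  qed
  ultimately have "grassmann_ideal \<subseteq> ?J"
    unfolding grassmann_ideal_def by (intro hull_minimal)
  moreover assume "(1 :: 'c gr_poly) \<in> grassmann_ideal"
  ultimately have "lookup (1 :: 'c gr_poly) 0 = 0"
    by blast
  thus False by simp
qed

quotient_type (overloaded) 'c grassmann =
  "'c::comm_ring_1 gr_poly" / "\<lambda>p q. p - q \<in> grassmann_ideal"
  by (rule ideal_congruence_equivp[OF module_smult two_sided_ideal_grassmann_ideal])

instantiation grassmann :: (comm_ring_1) ring_1
begin
lift_definition zero_grassmann :: "'a grassmann" is 0 .
lift_definition one_grassmann :: "'a grassmann" is 1 .
lift_definition plus_grassmann :: "'a grassmann \<Rightarrow> 'a grassmann \<Rightarrow> 'a grassmann"
  is "(+)" by (rule grassmann_ops)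
lift_definition minus_grassmann :: "'a grassmann \<Rightarrow> 'a grassmann \<Rightarrow> 'a grassmann"
  is "(-)" by (rule grassmann_ops)
lift_definition uminus_grassmann :: "'a grassmann \<Rightarrow> 'a grassmann"
  is uminus by (rule grassmann_ops)
lift_definition times_grassmann :: "'a grassmann \<Rightarrow> 'a grassmann \<Rightarrow> 'a grassmann"
  is "(*)" by (rule grassmann_ops)
instance
proof
  show "(0 :: 'a grassmann) \<noteq> 1"
  proof transfer
    show "0 - 1 \<notin> (grassmann_ideal :: 'a gr_poly set)"
      using one_notin_grassmann_ideal
        two_sided_idealD(4)[OF module_smult two_sided_ideal_grassmann_ideal, of "0 - 1 :: 'a gr_poly"]
      by auto
  qed
qed (transfer, simp add: algebra_simps
    two_sided_idealD(1)[OF module_smult two_sided_ideal_grassmann_ideal])+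
end

lift_definition eps_scale :: "'c::comm_ring_1 eps_ring \<Rightarrow> 'c grassmann \<Rightarrow> 'c grassmann" is smult
  by (rule grassmann_ops)

text \<open>The \<open>C\<close>-algebra structure is the one obtained along the canonical map from \<open>C\<close> to \<open>C[\<epsilon>]\<close>.\<close>

definition gr_scale :: "'c::comm_ring_1 \<Rightarrow> 'c grassmann \<Rightarrow> 'c grassmann" where
  "gr_scale c x = eps_scale (eps_const c) x"

lift_definition gr_gen :: "nat \<Rightarrow> 'c::comm_ring_1 grassmann" is gvar .

lemma commutator_gr_gen:
  "commutator (gr_gen i) (gr_gen j :: 'c::comm_ring_1 grassmann) =
     eps_scale (eps i * eps j) (gr_gen i * gr_gen j)"
proof -
  have "commutator (gvar i) (gvar j) - smult (eps i * eps j) (gvar i * gvar j)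
      \<in> (grassmann_ideal :: 'c gr_poly set)"
    unfolding grassmann_ideal_def grassmann_relations_def by (rule hull_inc) blast
  thus ?thesis
    unfolding commutator_def gr_gen.abs_eq times_grassmann.abs_eq minus_grassmann.abs_eq
      eps_scale.abs_eq grassmann.abs_eq_iff .
qed

interpretation eps_grassmann:
  assoc_algebra "eps_scale :: 'c::comm_ring_1 eps_ring \<Rightarrow> 'c grassmann \<Rightarrow> _"
proof
  note abs = eps_scale.abs_eq plus_grassmann.abs_eq times_grassmann.abs_eq
  fix c d :: "'c eps_ring" and x y :: "'c grassmann"
  have "\<exists>p. z = abs_grassmann p" for z :: "'c grassmann"
    by (induction z rule: grassmann.abs_induct) blast
  then obtain p q where [simp]: "x = abs_grassmann p" "y = abs_grassmann q"
    by meson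
  show "eps_scale c (x + y) = eps_scale c x + eps_scale c y"
    by (simp add: abs monoid_algebra.scale_right_distrib)
  show "eps_scale (c + d) x = eps_scale c x + eps_scale d x"
    by (simp add: abs monoid_algebra.scale_left_distrib)
  show "eps_scale c (eps_scale d x) = eps_scale (c * d) x"
    by (simp add: abs)
  show "eps_scale 1 x = x"
    by (simp add: abs)
  show "eps_scale c (x * y) = eps_scale c x * y"
    by (simp add: abs monoid_algebra.scale_mult_left)
  show "eps_scale c (x * y) = x * eps_scale c y"
    by (simp add: abs monoid_algebra.scale_mult_right)
qed

interpretation grassmann: assoc_algebra "gr_scale :: 'c::comm_ring_1 \<Rightarrow> 'c grassmann \<Rightarrow> _"
  proof
  fix c d :: 'c and x y :: "'c grassmann"
  show "gr_scale c (x + y) = gr_scale c x + gr_scale c y"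
    by (simp add: gr_scale_def eps_grassmann.scale_right_distrib)
  show "gr_scale (c + d) x = gr_scale c x + gr_scale d x"
    by (simp add: gr_scale_def eps_const_hom eps_grassmann.scale_left_distrib)
  show "gr_scale c (gr_scale d x) = gr_scale (c * d) x" "gr_scale 1 x = x"
    by (simp_all add: gr_scale_def eps_const_hom)
  show "gr_scale c (x * y) = gr_scale c x * y" "gr_scale c (x * y) = x * gr_scale c y"
    unfolding gr_scale_def by (rule eps_grassmann.scale_mult_left eps_grassmann.scale_mult_right)+
qed

end

theory Submission
  imports Defs "HOL-Library.Multiset"
begin

text \<open>
  Two facts are compared: how large the free algebra modulo the T-ideal \<open>T\<close> of the Grassmann identity
  can be, and how many of its elements the algebra \<open>\<GG>\<close> can tell apart.

  Upper bound. If all commutators are central, the product rule applied to \<open>[[ad, c], b] = 0\<close> gives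
  \<open>[a, b] [c, d] = - [a, c] [b, d]\<close> and \<open>[a, b] [b, c] = 0\<close>. A product of commutators is therefore an
  alternating function of the list of all its entries, and sorting letters at the cost of commutators
  shows that the normal monomials \<open>x\<^sub>s\<^sub>1 \<dots> x\<^sub>s\<^sub>m [x\<^sub>k\<^sub>1, x\<^sub>k\<^sub>2] [x\<^sub>k\<^sub>3, x\<^sub>k\<^sub>4] \<dots>\<close>, with \<open>s\<close> weakly and
  \<open>k\<close> strictly increasing, span everything modulo \<open>T\<close> (\<open>product_in_span_normal\<close>,
  \<open>normal_form_modulo_T_ideal\<close>).

  Lower bound. In a nontrivial combination of normal monomials choose one whose \<open>k\<close> is as short as
  possible, and substitute \<open>e\<^sub>2\<^sub>i\<^sup>2 + e\<^sub>2\<^sub>i\<^sub>+\<^sub>1\<close> for \<open>x\<^sub>i\<close> if \<open>i\<close> occurs in \<open>k\<close> and \<open>e\<^sub>2\<^sub>i\<^sup>2\<close> otherwise.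
  Squares of generators are central in \<open>\<GG>\<close>, so every monomial with a different list of commutator
  entries dies. In the others the commutators produce \<open>\<epsilon>\<^sub>v e\<^sub>v\<close>, where \<open>v\<close> is the word of the generators
  \<open>e\<^sub>2\<^sub>j\<^sub>+\<^sub>1\<close> for \<open>j\<close> in \<open>k\<close>. After multiplication by \<open>\<theta>\<close> a second occurrence of such a generator is fatal,
  because \<open>\<theta> \<epsilon>\<^sub>i e\<^sub>i\<^sup>2 = 0\<close>, so that only the central squares survive of the remaining letters
  (\<open>generic_normal_product\<close>). The resulting words are linearly independent even with the coefficient
  \<open>\<theta> \<epsilon>\<^sub>v\<close> (\<open>gr_words_independent\<close>); this is seen from explicit functionals that vanish on the defining
  relations of \<open>\<GG>\<close>. As each \<open>e\<^sub>2\<^sub>i\<^sup>2\<close> behaves like a polynomial variable,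
  the argument is the same in all characteristics.

  That \<open>\<GG>\<close> satisfies the Grassmann identity at all is due to the fact that arbitrary words, and not
  only the generators, commute according to \<open>[x, y] = \<alpha> \<beta> x y\<close> for elements of \<open>C[\<epsilon>]\<close> with
  \<open>\<alpha>\<^sup>2 = \<theta> \<alpha>\<close> and \<open>\<beta>\<^sup>2 = \<theta> \<beta>\<close> (\<open>skew_commute_words\<close>).
\<close>

section \<open>Rings with central commutators\<close>

text \<open>
  Both the relatively free algebra and \<open>\<GG>\<close> will be instances, so that the consequences of the
  Grassmann identity are derived once for both.
\<close>

class grassmann_ring = ring_1 +
  assumes commutator_commutes: "(x * y - y * x) * z = z * (x * y - y * x)"

lemma commutator_central:
  fixes x y z :: "'a::grassmann_ring"
  shows "commutator x y * z = z * commutator x y"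
  unfolding commutator_def by (rule commutator_commutes)

lemma commutator_mult_left:
  "commutator (x * y) z = x * commutator y z + commutator x z * (y :: 'a::ring)"
  by (simp add: commutator_def algebra_simps)

lemma commutator_mult_right:
  "commutator x (y * z) = y * commutator x z + commutator x y * (z :: 'a::ring)"
  by (simp add: commutator_def algebra_simps)

lemma commutator_swap: "commutator y x = - commutator x (y :: 'a::ring)"
  by (simp add: commutator_def)

lemma commutator_same [simp]: "commutator x x = (0 :: 'a::ring)"
  by (simp add: commutator_def)

text \<open>
  The product rule turns \<open>[[a d, c], b] = 0\<close> into a sum of four terms; the two that contain a double
  commutator vanish.
\<close>

lemma commutator_mult_exchange_sum:
  fixes a b c d :: "'a::grassmann_ring"
  shows "commutator a b * commutator d c + commutator a c * commutator d b = 0"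
proof -
  have "commutator (commutator x y) z = 0" for x y z :: 'a
    by (simp add: commutator_def[of "commutator x y"] commutator_central)
  hence "commutator (a * commutator d c + commutator a c * d) b = 0"
    by (simp only: flip: commutator_mult_left)
  moreover have "commutator (x + y) b = commutator x b + commutator y b" for x y
    by (simp add: commutator_def algebra_simps)
  ultimately show ?thesis
    using \<open>\<And>x y z. commutator (commutator x y) z = 0\<close> by (simp add: commutator_mult_left)
qed

lemma commutator_mult_exchange:
  fixes a b c d :: "'a::grassmann_ring"
  shows "commutator a b * commutator c d = - (commutator a c * commutator b d)"
  using commutator_mult_exchange_sum[of a b d c] commutator_swap[of d c] commutator_swap[of d b]
  by (simp add: add_eq_0_iff2) (metis minus_minus)

text \<open>
  Over rings in which \<open>2\<close> is a zero divisor this is more than antisymmetry. It is the case of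
  \<open>commutator_mult_exchange_sum\<close> in which one of the two summands contains \<open>[b, b]\<close>.
\<close>

lemma commutator_mult_shared:
  fixes a b c :: "'a::grassmann_ring"
  shows "commutator a b * commutator b c = 0"
  using commutator_mult_exchange_sum[of b b c a] commutator_swap[of a b] commutator_swap[of c b]
  by simp

text \<open>
  Consecutive entries are paired. Only lists of even length matter; otherwise the last entry is
  dropped.
\<close>

fun commutator_prod :: "'a::ring_1 list \<Rightarrow> 'a" where
  "commutator_prod (x # y # zs) = commutator x y * commutator_prod zs"
| "commutator_prod _ = 1"

lemma commutator_prod_central:
  "commutator_prod xs * z = z * (commutator_prod xs :: 'a::grassmann_ring)"
proof (induction xs rule: commutator_prod.induct)
  case (1 x y zs)
  have "commutator x y * commutator_prod zs * z = commutator x y * (z * commutator_prod zs)"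
    by (simp add: 1 mult.assoc)
  also have "\<dots> = z * commutator x y * commutator_prod zs"
    by (simp add: commutator_central flip: mult.assoc)
  finally show ?case by (simp add: mult.assoc)
qed simp_all

text \<open>
  The two entries either form a pair, or they belong to neighbouring pairs and
  \<open>commutator_mult_exchange\<close> applies. The parity condition excludes an entry without partner.
\<close>

lemma commutator_prod_swap:
  fixes x y :: "'a::grassmann_ring"
  assumes "even (length (ls @ rs))"
  shows "commutator_prod (ls @ x # y # rs) = - commutator_prod (ls @ y # x # rs)"
  using assms
proof (induction ls rule: commutator_prod.induct)
  case ("2_2" a)
  then obtain r rs' where "rs = r # rs'" by (cases rs) auto
  thus ?case
    by (simp flip: mult.assoc) (simp add: commutator_mult_exchange[of a x])
qed (simp_all add: commutator_swap[of x y])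

lemma commutator_prod_repeated:
  fixes x :: "'a::grassmann_ring"
  assumes "even (length (ls @ rs))"
  shows "commutator_prod (ls @ x # x # rs) = 0"
  using assms
proof (induction ls rule: commutator_prod.induct)
  case ("2_2" a)
  then obtain r rs' where "rs = r # rs'" by (cases rs) auto
  thus ?case
    by (simp add: commutator_mult_shared flip: mult.assoc)
qed simp_all

section \<open>Normal monomials\<close>

text \<open>
  Insertion sort only exchanges neighbours, hence a property that survives such exchanges can be
  transferred from a sorted list back to the unsorted one.
\<close>

lemma adjacent_swaps_insort:
  assumes swap: "\<And>ls x y rs. P (ls @ x # y # rs) \<Longrightarrow> P (ls @ y # x # rs)"
  shows "P (ls @ insort x xs) \<Longrightarrow> P (ls @ x # xs)"
proof (induction xs arbitrary: ls)
  case (Cons y ys)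
  show ?case
  proof (cases "x \<le> y")
    case False
    hence "P (ls @ y # x # ys)"
      using Cons.IH[of "ls @ [y]"] Cons.prems by simp
    thus ?thesis by (rule swap)
  qed (use Cons.prems in simp)
qed simp

lemma adjacent_swaps_sort:
  fixes xs :: "'a::linorder list"
  assumes swap: "\<And>ls x y rs. P (ls @ x # y # rs) \<Longrightarrow> P (ls @ y # x # rs)"
    and sorted: "P (sort xs)"
  shows "P xs"
proof -
  have "P (ls @ sort xs) \<Longrightarrow> P (ls @ xs)" for ls
  proof (induction xs arbitrary: ls)
    case (Cons x xs)
    have "P ((ls @ [x]) @ sort xs)"
      using adjacent_swaps_insort[of P ls x "sort xs", OF swap] Cons.prems by simp
    thus ?case using Cons.IH[of "ls @ [x]"] by simp
  qed simp
  from this[of "[]"] sorted show ?thesis by simp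
qed

lemma sorted_not_distinct_decomp:
  assumes "sorted xs" "\<not> distinct xs"
  obtains ls x rs where "xs = ls @ x # x # rs"
proof -
  have "\<exists>ls x rs. xs = ls @ x # x # rs"
    using assms
  proof (induction xs)
    case (Cons x xs)
    show ?case
    proof (cases "distinct xs")
      case True
      with Cons.prems have "x \<in> set xs" by simp
      with Cons.prems(1) have "hd xs = x" "xs \<noteq> []"
        by (cases xs; force)+
      hence "x # xs = [] @ x # x # tl xs" by (cases xs) auto
      thus ?thesis by blast
    next
      case False
      with Cons obtain ls y rs where "xs = ls @ y # y # rs" by auto
      hence "x # xs = (x # ls) @ y # y # rs" by simp
      thus ?thesis by blast
    qed
  qed simp
  thus ?thesis using that by blast
qed

text \<open>
  The pair \<open>(s, k)\<close> stands for the normal monomial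
  \<open>x\<^sub>s\<^sub>1 x\<^sub>s\<^sub>2 \<dots> [x\<^sub>k\<^sub>1, x\<^sub>k\<^sub>2] [x\<^sub>k\<^sub>3, x\<^sub>k\<^sub>4] \<dots>\<close>.
\<close>

definition normal_indices :: "(nat list \<times> nat list) set" where
  "normal_indices = {(s, k). sorted s \<and> sorted k \<and> distinct k \<and> even (length k)}"

definition normal_product :: "(nat \<Rightarrow> 'a::ring_1) \<Rightarrow> nat list \<times> nat list \<Rightarrow> 'a" where
  "normal_product a = (\<lambda>(s, k). prod_list (map a s) * commutator_prod (map a k))"

text \<open>
  Exchanging two neighbouring letters of \<open>w\<close> costs a term in which they have become a central
  commutator and moved into \<open>k\<close>; its word is shorter. Once \<open>w\<close> is sorted, \<open>k\<close> may be sorted as well,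
  which only affects the sign, and a repeated entry of \<open>k\<close> makes the product vanish.
\<close>

lemma product_in_span_normal:
  fixes a :: "nat \<Rightarrow> 'b::grassmann_ring" and sc :: "'c::comm_ring_1 \<Rightarrow> 'b \<Rightarrow> 'b"
  assumes "module sc"
  defines "N \<equiv> module.span sc (normal_product a ` normal_indices)"
  assumes "even (length k)"
  shows "prod_list (map a w) * commutator_prod (map a k) \<in> N"
  using assms(3)
proof (induction "length w" arbitrary: w k rule: less_induct)
  case less
  interpret M: module sc by fact
  have neg: "- x \<in> N \<longleftrightarrow> x \<in> N" for x
    unfolding N_def using M.span_neg[of x] M.span_neg[of "-x"] by auto
  define P where "P u \<longleftrightarrow> length u = length w \<and>
    prod_list (map a u) * commutator_prod (map a k) \<in> N" for u
  have "P w"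
  proof (rule adjacent_swaps_sort)
    fix ls x y rs assume P: "P (ls @ x # y # rs)"
    have "prod_list (map a (ls @ rs)) * commutator_prod (map a (y # x # k)) \<in> N"
      by (rule less.hyps) (use P less.prems in \<open>auto simp: P_def\<close>)
    moreover have "prod_list (map a (ls @ y # x # rs)) * commutator_prod (map a k)
      = prod_list (map a (ls @ x # y # rs)) * commutator_prod (map a k)
        + prod_list (map a (ls @ rs)) * commutator_prod (map a (y # x # k))"
    proof -
      have "a y * a x = a x * a y + commutator (a y) (a x)"
        by (simp add: commutator_def)
      hence "prod_list (map a (ls @ y # x # rs)) = prod_list (map a (ls @ x # y # rs))
          + prod_list (map a ls) * (commutator (a y) (a x) * prod_list (map a rs))"
        by (simp add: algebra_simps flip: mult.assoc)
      also have "commutator (a y) (a x) * prod_list (map a rs)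
          = prod_list (map a rs) * commutator (a y) (a x)"
        by (rule commutator_central)
      finally show ?thesis by (simp add: algebra_simps)
    qed
    ultimately show "P (ls @ y # x # rs)"
      using P unfolding P_def N_def by (auto intro: M.span_add)
  next
    let ?Q = "\<lambda>l. even (length l) \<and>
      prod_list (map a (sort w)) * commutator_prod (map a l) \<in> N"
    have "?Q k"
    proof (rule adjacent_swaps_sort[where P = ?Q])
      fix ls x y rs assume "?Q (ls @ x # y # rs)"
      thus "?Q (ls @ y # x # rs)"
        using commutator_prod_swap[of "map a ls" "map a rs" "a y" "a x"] neg by auto
    next
      show "?Q (sort k)"
      proof (cases "distinct k")
        case True
        hence "(sort w, sort k) \<in> normal_indices"
          using less.prems by (simp add: normal_indices_def)
        thus ?thesis
          using less.prems unfolding N_def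
          by (force intro!: M.span_base simp: normal_product_def image_iff)
      next
        case False
        then obtain ls x rs where k: "sort k = ls @ x # x # rs"
          using sorted_not_distinct_decomp[of "sort k"] by auto
        have "even (length (sort k))" using less.prems by simp
        hence "even (length (ls @ rs))" unfolding k by simp
        hence "commutator_prod (map a (sort k)) = 0"
          using commutator_prod_repeated[of "map a ls" "map a rs" "a x"] by (simp add: k)
        thus ?thesis using less.prems by (simp add: N_def M.span_zero)
      qed
    qed
    thus "P (sort w)" by (simp add: P_def)
  qed
  thus ?case by (simp add: P_def)
qed

section \<open>Linear maps on monoid algebras\<close>

lemma poly_mapping_induct [case_names zero single add]:
  fixes p :: "'k \<Rightarrow>\<^sub>0 'c::comm_monoid_add"
  assumes "P 0" "\<And>k c. P (single k c)" "\<And>p q. P p \<Longrightarrow> P q \<Longrightarrow> P (p + q)"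
  shows "P p"
proof (induction p rule: update_induct)
  case (update f m c)
  have "Poly_Mapping.update m c f = single m c + f"
    using update(1)
    by (intro poly_mapping_eqI)
      (auto simp: lookup_update lookup_add lookup_single when_def in_keys_iff)
  with update(3) show ?case by (simp add: assms)
qed (rule assms)

definition linear_extension ::
  "('c::comm_ring_1 \<Rightarrow> 'b::ab_group_add \<Rightarrow> 'b) \<Rightarrow> ('k \<Rightarrow> 'b) \<Rightarrow> ('k \<Rightarrow>\<^sub>0 'c) \<Rightarrow> 'b" where
  "linear_extension scale g p = (\<Sum>k\<in>keys p. scale (lookup p k) (g k))"

context module
begin

lemma linear_extension_superset:
  assumes "finite A" "keys p \<subseteq> A"
  shows "linear_extension scale g p = (\<Sum>k\<in>A. scale (lookup p k) (g k))"
  unfolding linear_extension_def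
  by (rule sum.mono_neutral_left) (use assms in \<open>auto simp: in_keys_iff\<close>)

lemma linear_extension_add:
  "linear_extension scale g (p + q) = linear_extension scale g p + linear_extension scale g q"
proof -
  have "linear_extension scale g r = (\<Sum>k\<in>keys p \<union> keys q. scale (lookup r k) (g k))"
    if "keys r \<subseteq> keys p \<union> keys q" for r
    by (rule linear_extension_superset) (use that in auto)
  thus ?thesis
    using Poly_Mapping.keys_add[of p q]
    by (simp add: lookup_add scale_left_distrib sum.distrib)
qed

lemma linear_extension_0 [simp]: "linear_extension scale g 0 = 0"
  by (simp add: linear_extension_def)

lemma linear_extension_single [simp]: "linear_extension scale g (single k c) = scale c (g k)"
  by (cases "c = 0") (simp_all add: linear_extension_def)

lemma linear_extension_smult:
  "linear_extension scale g (smult c p) = scale c (linear_extension scale g p)"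
proof -
  have "linear_extension scale g (smult c p) = (\<Sum>k\<in>keys p. scale (lookup (smult c p) k) (g k))"
    by (rule linear_extension_superset) (auto simp: in_keys_iff lookup_smult)
  thus ?thesis
    by (simp add: linear_extension_def lookup_smult scale_sum_right)
qed

lemma linear_extension_diff:
  "linear_extension scale g (p - q) = linear_extension scale g p - linear_extension scale g q"
  using linear_extension_add[of g "p - q" q] by simp

lemma linear_extension_sum:
  "linear_extension scale g (sum f A) = (\<Sum>x\<in>A. linear_extension scale g (f x))"
  by (induction A rule: infinite_finite_induct) (simp_all add: linear_extension_add)

end

lemma (in assoc_algebra) linear_extension_mult:
  fixes g :: "'k::monoid_add \<Rightarrow> 'a"
  assumes "\<And>k l. g (k + l) = g k * g l"
  shows "linear_extension scale g (p * q) = linear_extension scale g p * linear_extension scale g q"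
proof (induction p rule: poly_mapping_induct)
  case (single k c)
  show ?case
  proof (induction q rule: poly_mapping_induct)
    case (single l d)
    show ?case
      by (simp add: mult_single assms mult.commute flip: scale_mult_left scale_mult_right)
  qed (simp_all add: distrib_left linear_extension_add)
qed (simp_all add: distrib_right linear_extension_add)

text \<open>
  The elements \<open>x\<close> for which \<open>h\<close> kills all \<open>q x q'\<close> form an ideal, and by additivity it is enough
  to take monomials for \<open>q\<close> and \<open>q'\<close>. All functionals below are shown to be well defined on a
  quotient in this way.
\<close>

lemma vanishes_on_generated_ideal:
  fixes h :: "('k::monoid_add \<Rightarrow>\<^sub>0 'c::comm_ring_1) \<Rightarrow> 'b::ab_group_add"
  assumes add: "\<And>p q. h (p + q) = h p + h q"
    and gen: "\<And>k c r l d. r \<in> R \<Longrightarrow> h (single k c * r * single l d) = 0"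
    and p: "p \<in> two_sided_ideal smult hull R"
  shows "h p = 0"
proof -
  let ?J = "{x. \<forall>q q'. h (q * x * q') = 0}"
  have h0: "h 0 = 0" using add[of 0 0] by simp
  have "two_sided_ideal smult ?J"
  proof (rule two_sided_idealI[OF module_smult])
    have left: "a * x \<in> ?J" if "x \<in> ?J" for a x
      using that by (simp flip: mult.assoc)
    show "a * x \<in> ?J" if "x \<in> ?J" for a x
      using that by (rule left)
    show "smult c x \<in> ?J" if "x \<in> ?J" for c x
      unfolding smult_conv_mult using that by (rule left)
    show "x * a \<in> ?J" if "x \<in> ?J" for a x
      using that by (simp add: mult.assoc)
  qed (simp_all add: h0 distrib_left distrib_right add)
  moreover have "R \<subseteq> ?J"
  proof safe
    fix r q q' assume r: "r \<in> R"
    show "h (q * r * q') = 0"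
    proof (induction q rule: poly_mapping_induct)
      case (single k c)
      show ?case
        by (induction q' rule: poly_mapping_induct) (simp_all add: h0 gen[OF r] distrib_left add)
    qed (simp_all add: h0 distrib_right add)
  qed
  ultimately have "p \<in> ?J"
    using hull_minimal[of R ?J "two_sided_ideal smult"] p by blast
  hence "h (1 * p * 1) = 0" by blast
  thus ?thesis by simp
qed

section \<open>Evaluation and substitution\<close>

text \<open>
  In a unital algebra also polynomials with a constant term can be evaluated, which makes evaluation
  a multiplicative map on the whole monoid algebra.
\<close>

definition unital_evaluate ::
  "('c::comm_ring_1 \<Rightarrow> 'a::ring_1 \<Rightarrow> 'a) \<Rightarrow> (nat \<Rightarrow> 'a) \<Rightarrow> (nat word \<Rightarrow>\<^sub>0 'c) \<Rightarrow> 'a" where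
  "unital_evaluate scale a = linear_extension scale (\<lambda>w. prod_list (map a (letters w)))"

lemma unital_evaluate_mult:
  assumes "assoc_algebra scale"
  shows "unital_evaluate scale a (p * q) = unital_evaluate scale a p * unital_evaluate scale a q"
  unfolding unital_evaluate_def
  by (rule assoc_algebra.linear_extension_mult[OF assms]) (simp add: plus_word_def)

lemma unital_evaluate_linear:
  assumes "module scale"
  shows "unital_evaluate scale a (p + q) = unital_evaluate scale a p + unital_evaluate scale a q"
    "unital_evaluate scale a (p - q) = unital_evaluate scale a p - unital_evaluate scale a q"
    "unital_evaluate scale a (smult c p) = scale c (unital_evaluate scale a p)"
    "unital_evaluate scale a (sum f A) = (\<Sum>x\<in>A. unital_evaluate scale a (f x))"
  unfolding unital_evaluate_def
  by (simp_all add: module.linear_extension_add[OF assms] module.linear_extension_diff[OF assms]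
      module.linear_extension_smult[OF assms] module.linear_extension_sum[OF assms])

lemma unital_evaluate_one:
  assumes "module scale" shows "unital_evaluate scale a 1 = 1"
  unfolding unital_evaluate_def single_one[symmetric] module.linear_extension_single[OF assms]
  by (simp add: zero_word_def module.scale_one[OF assms])

lemma unital_evaluate_word:
  assumes "module scale"
  shows "unital_evaluate scale a (single (Word w) 1) = prod_list (map a w)"
  unfolding unital_evaluate_def module.linear_extension_single[OF assms]
  by (simp add: module.scale_one[OF assms])

lemma nonempty_prod_eq_prod_list:
  "xs \<noteq> [] \<Longrightarrow> nonempty_prod xs = prod_list (xs :: 'a::monoid_mult list)"
  by (induction xs rule: nonempty_prod.induct) simp_all

lemma ncpoly_nonempty: "w \<in> keys (ncpoly f) \<Longrightarrow> letters w \<noteq> []"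
  using ncpoly[of f] by (cases w) (auto simp: in_keys_iff zero_word_def)

lemma evaluate_eq_unital_evaluate:
  "evaluate scale a f = unital_evaluate scale (a :: nat \<Rightarrow> 'a::ring_1) (ncpoly f)"
  unfolding evaluate_def unital_evaluate_def linear_extension_def
  by (intro sum.cong) (simp_all add: nonempty_prod_eq_prod_list ncpoly_nonempty)

lemma map_nonempty_prod:
  assumes "\<And>x y. \<psi> (x * y) = \<psi> x * \<psi> y"
  shows "xs \<noteq> [] \<Longrightarrow> \<psi> (nonempty_prod xs) = nonempty_prod (map \<psi> xs)"
  by (induction xs rule: nonempty_prod.induct) (simp_all add: assms)

lemma algebra_hom_evaluate:
  assumes "algebra_hom scaleA scaleB \<psi>"
  shows "\<psi> (evaluate scaleA b f) = evaluate scaleB (\<psi> \<circ> b) f"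
proof -
  have "module_hom scaleA scaleB \<psi>" and mult: "\<And>x y. \<psi> (x * y) = \<psi> x * \<psi> y"
    using assms by (auto simp: algebra_hom_def)
  then interpret module_hom scaleA scaleB \<psi> by simp
  have "\<psi> (nonempty_prod (map b (letters w))) = nonempty_prod (map (\<psi> \<circ> b) (letters w))"
    if "w \<in> keys (ncpoly f)" for w
    using ncpoly_nonempty[OF that] by (simp add: map_nonempty_prod[of \<psi>] mult)
  thus ?thesis
    unfolding evaluate_def sum scale by (intro sum.cong) auto
qed

lemma algebra_hom_ncpoly: "algebra_hom fsmult smult ncpoly"
  unfolding algebra_hom_def
  by (auto intro!: module_hom.intro module_hom_axioms.intro module_smult free_algebra.module_axioms
      simp: plus_free_algebra.rep_eq fsmult.rep_eq times_free_algebra.rep_eq)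

lemma unital_evaluate_letters:
  "unital_evaluate smult (\<lambda>n. single (Word [n]) 1) p = (p :: nat word \<Rightarrow>\<^sub>0 'c::comm_ring_1)"
proof -
  have w: "prod_list (map (\<lambda>n. single (Word [n]) (1::'c)) w) = single (Word w) 1" for w
    by (induction w) (simp_all add: mult_single plus_word_def zero_word_def flip: single_one)
  have "unital_evaluate smult (\<lambda>n. single (Word [n]) (1::'c)) (single k c) = single k c" for k c
    unfolding unital_evaluate_def module.linear_extension_single[OF module_smult] w
    by (simp add: smult_conv_mult mult_single)
  thus ?thesis
    by (induction p rule: poly_mapping_induct)
      (simp_all add: unital_evaluate_linear[OF module_smult],
        simp add: unital_evaluate_def module.linear_extension_0[OF module_smult])
qed

lemma evaluate_letters: "evaluate fsmult letter f = f"
  using algebra_hom_evaluate[OF algebra_hom_ncpoly, of letter f]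
  by (simp add: evaluate_eq_unital_evaluate comp_def letter.rep_eq unital_evaluate_letters
      ncpoly_inject)

lemma algebra_hom_evaluate_unital:
  fixes scale :: "'c::comm_ring_1 \<Rightarrow> 'a::ring_1 \<Rightarrow> 'a"
  assumes "assoc_algebra scale"
  shows "algebra_hom fsmult scale (evaluate scale a)"
proof -
  interpret assoc_algebra scale by fact
  show ?thesis
    unfolding algebra_hom_def evaluate_eq_unital_evaluate
    by (auto intro!: module_hom.intro module_hom_axioms.intro module_axioms
        free_algebra.module_axioms
        simp: plus_free_algebra.rep_eq fsmult.rep_eq times_free_algebra.rep_eq
          unital_evaluate_mult[OF assms] unital_evaluate_linear[OF module_axioms])
qed

text \<open>
  The free algebra itself has no unit. Its substitutions are therefore followed by the embedding into
  the unital free algebra, where evaluation is known to be multiplicative.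
\<close>

lemma algebra_hom_substitution: "algebra_hom fsmult fsmult (evaluate fsmult b)"
proof -
  have "ncpoly (evaluate fsmult b f) = evaluate smult (ncpoly \<circ> b) f" for f :: "'a free_algebra"
    by (rule algebra_hom_evaluate[OF algebra_hom_ncpoly])
  moreover have "algebra_hom fsmult smult (evaluate smult (ncpoly \<circ> b))"
    by (rule algebra_hom_evaluate_unital) (rule monoid_algebra.assoc_algebra_axioms)
  ultimately show ?thesis
    unfolding algebra_hom_def module_hom_iff ncpoly_inject[symmetric]
    by (simp add: plus_free_algebra.rep_eq fsmult.rep_eq times_free_algebra.rep_eq
        free_algebra.module_axioms)
qed

lemma algebra_hom_comp:
  "algebra_hom s1 s2 f \<Longrightarrow> algebra_hom s2 s3 g \<Longrightarrow> algebra_hom s1 s3 (g \<circ> f)"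
  unfolding algebra_hom_def module_hom_iff by simp

text \<open>
  An evaluation preceded by an endomorphism is again an evaluation, as homomorphisms out of the free
  algebra are determined by the images of the letters.
\<close>

lemma T_ideal_identities:
  fixes scale :: "'c::comm_ring_1 \<Rightarrow> 'a::ring_1 \<Rightarrow> 'a"
  assumes "assoc_algebra scale"
  shows "T_ideal (identities scale)"
  unfolding T_ideal_def
proof (intro conjI allI impI subsetI)
  interpret assoc_algebra scale by fact
  have hom: "module_hom fsmult scale (evaluate scale a)"
    "evaluate scale a (x * y) = evaluate scale a x * evaluate scale a y" for a x y
    using algebra_hom_evaluate_unital[OF assms, of a] by (simp_all add: algebra_hom_def)
  note simps = module_hom.add[OF hom(1)] module_hom.scale[OF hom(1)] module_hom.zero[OF hom(1)]
  show "two_sided_ideal fsmult (identities scale)"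
    by (rule two_sided_idealI)
      (simp_all add: identities_def simps hom(2) free_algebra.module_axioms)
  fix \<phi> f assume \<phi>: "algebra_hom fsmult fsmult \<phi>" and "f \<in> \<phi> ` identities scale"
  then obtain g where g: "g \<in> identities scale" "f = \<phi> g" by blast
  have "evaluate scale a (\<phi> g) = 0" for a
  proof -
    have "algebra_hom fsmult scale (evaluate scale a \<circ> \<phi>)"
      using \<phi> algebra_hom_evaluate_unital[OF assms] by (rule algebra_hom_comp)
    from algebra_hom_evaluate[OF this, of letter g] show ?thesis
      using g(1) by (simp add: evaluate_letters identities_def)
  qed
  thus "f \<in> identities scale" by (simp add: g(2) identities_def)
qed

section \<open>The relatively free algebra\<close>

definition grassmann_T_ideal :: "'c::comm_ring_1 free_algebra set" where
  "grassmann_T_ideal = T_ideal hull {commutator (letter 0) (commutator (letter 1) (letter 2))}"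

lemma T_ideal_grassmann_T_ideal: "T_ideal grassmann_T_ideal"
  unfolding grassmann_T_ideal_def by (rule T_ideal_hull)

lemma double_commutator_in_grassmann_T_ideal:
  "commutator x (commutator y z) \<in> grassmann_T_ideal"
proof -
  define \<phi> where "\<phi> = evaluate fsmult ((!) [x, y, z])"
  have hom: "algebra_hom fsmult fsmult \<phi>"
    unfolding \<phi>_def by (rule algebra_hom_substitution)
  have [simp]: "\<phi> (commutator f g) = commutator (\<phi> f) (\<phi> g)" for f g
    using hom module_hom.diff[of fsmult fsmult \<phi>]
    by (simp add: algebra_hom_def commutator_def)
  have "\<phi> ` grassmann_T_ideal \<subseteq> grassmann_T_ideal"
    using T_ideal_grassmann_T_ideal hom unfolding T_ideal_def by blast
  hence "\<phi> (commutator (letter 0) (commutator (letter 1) (letter 2))) \<in> grassmann_T_ideal"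
    using hull_subset[of _ T_ideal] unfolding grassmann_T_ideal_def by blast
  thus ?thesis
    by simp (simp add: \<phi>_def evaluate_letter free_algebra.module_axioms)
qed

text \<open>
  Viewed inside the unital free algebra the T-ideal remains an ideal. The quotient has a unit, and so
  products over empty lists need no special treatment in it.
\<close>

definition unital_T_ideal :: "(nat word \<Rightarrow>\<^sub>0 'c::comm_ring_1) set" where
  "unital_T_ideal = ncpoly ` grassmann_T_ideal"

lemma constant_plus_ncpoly:
  obtains c f where "p = single 0 c + ncpoly f"
proof
  show "p = single 0 (lookup p 0) + ncpoly (Abs_free_algebra (p - single 0 (lookup p 0)))"
    by (subst Abs_free_algebra_inverse) (simp_all add: lookup_minus)
qed

lemma two_sided_ideal_unital_T_ideal: "two_sided_ideal smult unital_T_ideal"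
proof (rule two_sided_idealI[OF module_smult])
  have "two_sided_ideal fsmult (grassmann_T_ideal :: 'a free_algebra set)"
    by (rule T_ideal_grassmann_T_ideal[unfolded T_ideal_def, THEN conjunct1])
  note D = two_sided_idealD[OF free_algebra.module_axioms this]
  note [simp] = unital_T_ideal_def
  show "0 \<in> (unital_T_ideal :: (nat word \<Rightarrow>\<^sub>0 'a) set)"
    using D(1) by (auto simp: image_iff zero_free_algebra.rep_eq[symmetric] ncpoly_inject)
  show add: "x + y \<in> unital_T_ideal"
    if "x \<in> unital_T_ideal" "y \<in> unital_T_ideal" for x y :: "nat word \<Rightarrow>\<^sub>0 'a"
    using that D(2) by (auto simp: image_iff plus_free_algebra.rep_eq[symmetric] ncpoly_inject)
  show smult: "smult c x \<in> unital_T_ideal"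
    if "x \<in> unital_T_ideal" for c and x :: "nat word \<Rightarrow>\<^sub>0 'a"
    using that D(5) by (auto simp: image_iff fsmult.rep_eq[symmetric] ncpoly_inject)
  fix a x :: "nat word \<Rightarrow>\<^sub>0 'a" assume x: "x \<in> unital_T_ideal"
  obtain c f where a: "a = single 0 c + ncpoly f"
    by (rule constant_plus_ncpoly)
  have "ncpoly f * x \<in> unital_T_ideal" "x * ncpoly f \<in> unital_T_ideal"
    using x D(6,7) by (auto simp: image_iff times_free_algebra.rep_eq[symmetric] ncpoly_inject)
  moreover have "a * x = smult c x + ncpoly f * x"
    by (simp add: a smult_conv_mult distrib_right)
  moreover have "x * a = smult c x + x * ncpoly f"
    using monoid_algebra.scale_mult_right[of c x 1]
    by (simp add: a smult_conv_mult distrib_left)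
  ultimately show "a * x \<in> unital_T_ideal" "x * a \<in> unital_T_ideal"
    using add smult[OF x] by metis+
qed

lemmas unital_T_ideal_ops = ideal_congruence_ops[OF module_smult two_sided_ideal_unital_T_ideal]

quotient_type (overloaded) 'c relatively_free =
  "nat word \<Rightarrow>\<^sub>0 'c::comm_ring_1" / "\<lambda>p q. p - q \<in> unital_T_ideal"
  by (rule ideal_congruence_equivp[OF module_smult two_sided_ideal_unital_T_ideal])

instantiation relatively_free :: (comm_ring_1) grassmann_ring
begin
lift_definition zero_relatively_free :: "'a relatively_free" is 0 .
lift_definition one_relatively_free :: "'a relatively_free" is 1 .
lift_definition plus_relatively_free ::
  "'a relatively_free \<Rightarrow> 'a relatively_free \<Rightarrow> 'a relatively_free"
  is "(+)" by (rule unital_T_ideal_ops)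
lift_definition minus_relatively_free ::
  "'a relatively_free \<Rightarrow> 'a relatively_free \<Rightarrow> 'a relatively_free"
  is "(-)" by (rule unital_T_ideal_ops)
lift_definition uminus_relatively_free :: "'a relatively_free \<Rightarrow> 'a relatively_free"
  is uminus by (rule unital_T_ideal_ops)
lift_definition times_relatively_free ::
  "'a relatively_free \<Rightarrow> 'a relatively_free \<Rightarrow> 'a relatively_free"
  is "(*)" by (rule unital_T_ideal_ops)
instance
proof
  show "(0 :: 'a relatively_free) \<noteq> 1"
  proof transfer
    have "lookup p 0 = 0" if "p \<in> unital_T_ideal" for p :: "nat word \<Rightarrow>\<^sub>0 'a"
      using that ncpoly by (auto simp: unital_T_ideal_def)
    from this[of "0 - 1"] show "0 - 1 \<notin> (unital_T_ideal :: (nat word \<Rightarrow>\<^sub>0 'a) set)"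
      by (auto simp: lookup_minus)
  qed
  fix x y z :: "'a relatively_free"
  show "(x * y - y * x) * z = z * (x * y - y * x)"
  proof transfer
    fix p q r :: "nat word \<Rightarrow>\<^sub>0 'a"
    obtain a f where p: "p = single 0 a + ncpoly f" by (rule constant_plus_ncpoly)
    obtain b g where q: "q = single 0 b + ncpoly g" by (rule constant_plus_ncpoly)
    obtain c h where r: "r = single 0 c + ncpoly h" by (rule constant_plus_ncpoly)
    \<comment> \<open>Constant terms are central and thus disappear from commutators, which leaves an identity
      between elements of the free algebra without unit.\<close>
    have scalar: "commutator (single 0 d) s = 0" "commutator s (single 0 d) = 0"
      for d and s :: "nat word \<Rightarrow>\<^sub>0 'a"
      using monoid_algebra.scale_mult_right[of d s 1] by (simp_all add: smult_conv_mult commutator_def)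
    have add: "commutator (s + t) u = commutator s u + commutator t u"
      "commutator u (s + t) = commutator u s + commutator u t" for s t u :: "nat word \<Rightarrow>\<^sub>0 'a"
      by (simp_all add: commutator_def distrib_left distrib_right)
    have "commutator r (commutator p q) = ncpoly (commutator h (commutator f g))"
      unfolding p q r add scalar
      by (simp add: commutator_def minus_free_algebra.rep_eq times_free_algebra.rep_eq)
    hence "(p * q - q * p) * r - r * (p * q - q * p) = - ncpoly (commutator h (commutator f g))"
      unfolding commutator_def[of r] commutator_def[of p] by (metis minus_diff_eq)
    also have "\<dots> \<in> unital_T_ideal"
      by (intro two_sided_idealD(4)[OF module_smult two_sided_ideal_unital_T_ideal])
        (simp add: unital_T_ideal_def double_commutator_in_grassmann_T_ideal)
    finally show "(p * q - q * p) * r - r * (p * q - q * p) \<in> unital_T_ideal" .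
  qed
qed (transfer, simp add: algebra_simps
    two_sided_idealD(1)[OF module_smult two_sided_ideal_unital_T_ideal])+
end

lift_definition relatively_free_scale ::
  "'c::comm_ring_1 \<Rightarrow> 'c relatively_free \<Rightarrow> 'c relatively_free" is smult
  by (rule unital_T_ideal_ops)

lemma module_relatively_free: "module relatively_free_scale"
  by standard
    (transfer, simp add: monoid_algebra.scale_right_distrib monoid_algebra.scale_left_distrib
      two_sided_idealD(1)[OF module_smult two_sided_ideal_unital_T_ideal])+

lemma abs_relatively_free_hom:
  "abs_relatively_free (p + q) = abs_relatively_free p + abs_relatively_free q"
  "abs_relatively_free (p - q) = abs_relatively_free p - abs_relatively_free q"
  "abs_relatively_free (p * q) = abs_relatively_free p * abs_relatively_free q"
  "abs_relatively_free 1 = 1"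
  "abs_relatively_free 0 = 0"
  "abs_relatively_free (smult c p) = relatively_free_scale c (abs_relatively_free p)"
  by (simp_all add: plus_relatively_free.abs_eq minus_relatively_free.abs_eq
      times_relatively_free.abs_eq one_relatively_free.abs_eq zero_relatively_free.abs_eq
      relatively_free_scale.abs_eq)

lemma abs_relatively_free_eq_iff:
  "abs_relatively_free p = abs_relatively_free q \<longleftrightarrow> p - q \<in> unital_T_ideal"
  by (rule relatively_free.abs_eq_iff)

lemma normal_product_hom:
  fixes \<psi> :: "'a::ring_1 \<Rightarrow> 'b::ring_1"
  assumes "\<And>x y. \<psi> (x - y) = \<psi> x - \<psi> y" "\<And>x y. \<psi> (x * y) = \<psi> x * \<psi> y" "\<psi> 1 = 1"
  shows "\<psi> (normal_product a sk) = normal_product (\<lambda>i. \<psi> (a i)) sk"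
proof -
  have "\<psi> (prod_list (map a s)) = prod_list (map (\<lambda>i. \<psi> (a i)) s)" for s
    by (induction s) (simp_all add: assms)
  moreover have "\<psi> (commutator_prod (map a k)) = commutator_prod (map (\<lambda>i. \<psi> (a i)) k)" for k
    by (induction k rule: induct_list012) (simp_all add: assms commutator_def)
  ultimately show ?thesis
    by (simp add: normal_product_def assms split: prod.split)
qed

text \<open>
  In the quotient by the T-ideal the letters generate a ring with central commutators, which is
  spanned by the normal monomials.
\<close>

lemma normal_form_modulo_T_ideal:
  fixes p :: "nat word \<Rightarrow>\<^sub>0 'c::comm_ring_1"
  obtains B c where "finite B" "B \<subseteq> normal_indices" "\<And>b. b \<in> B \<Longrightarrow> c b \<noteq> 0"
    "p - (\<Sum>b\<in>B. smult (c b) (normal_product (\<lambda>n. single (Word [n]) 1) b)) \<in> unital_T_ideal"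
proof -
  let ?X = "\<lambda>n. single (Word [n]) 1 :: nat word \<Rightarrow>\<^sub>0 'c"
  let ?\<pi> = "abs_relatively_free :: (nat word \<Rightarrow>\<^sub>0 'c) \<Rightarrow> _"
  interpret M: module "relatively_free_scale :: 'c \<Rightarrow> _" by (rule module_relatively_free)
  let ?N = "M.span (normal_product (\<lambda>n. ?\<pi> (?X n)) ` normal_indices)"
  have \<pi>: "?\<pi> (normal_product ?X b) = normal_product (\<lambda>n. ?\<pi> (?X n)) b" for b
    by (rule normal_product_hom) (simp_all add: abs_relatively_free_hom)
  have "?\<pi> (unital_evaluate smult ?X p) \<in> ?N"
  proof (induction p rule: poly_mapping_induct)
    case zero
    show ?case
      by (simp add: unital_evaluate_def module.linear_extension_0[OF module_smult]
          abs_relatively_free_hom M.span_zero)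
  next
    case (single k c)
    have "?\<pi> (prod_list (map ?X w)) = prod_list (map (\<lambda>n. ?\<pi> (?X n)) w)" for w
      by (induction w) (simp_all add: abs_relatively_free_hom)
    moreover have "prod_list (map (\<lambda>n. ?\<pi> (?X n)) (letters k)) * commutator_prod (map (\<lambda>n. ?\<pi> (?X n)) []) \<in> ?N"
      by (rule product_in_span_normal) (simp_all add: M.module_axioms)
    ultimately show ?case
      by (simp add: unital_evaluate_def module.linear_extension_single[OF module_smult]
          abs_relatively_free_hom M.span_scale)
  next
    case (add p q)
    thus ?case
      by (simp add: unital_evaluate_linear[OF module_smult] abs_relatively_free_hom M.span_add)
  qed
  hence "?\<pi> p \<in> ?N" by (simp only: unital_evaluate_letters)
  then obtain t r where t: "finite t" "t \<subseteq> normal_product (\<lambda>n. ?\<pi> (?X n)) ` normal_indices"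
    "?\<pi> p = (\<Sum>x\<in>t. relatively_free_scale (r x) x)"
    unfolding M.span_explicit by blast
  then obtain U where U: "U \<subseteq> normal_indices" "inj_on (normal_product (\<lambda>n. ?\<pi> (?X n))) U"
    "t = normal_product (\<lambda>n. ?\<pi> (?X n)) ` U"
    by (meson subset_image_inj)
  define c where "c b = r (normal_product (\<lambda>n. ?\<pi> (?X n)) b)" for b
  define B where "B = {b\<in>U. c b \<noteq> 0}"
  have finU: "finite U" using t(1) U by (simp add: finite_image_iff)
  have "?\<pi> p = (\<Sum>b\<in>U. relatively_free_scale (c b) (?\<pi> (normal_product ?X b)))"
    unfolding t(3) U(3) by (subst sum.reindex[OF U(2)]) (simp add: c_def \<pi>)
  also have "\<dots> = (\<Sum>b\<in>B. relatively_free_scale (c b) (?\<pi> (normal_product ?X b)))"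
    by (rule sum.mono_neutral_right) (use finU in \<open>auto simp: B_def\<close>)
  also have "\<dots> = ?\<pi> (\<Sum>b\<in>B. smult (c b) (normal_product ?X b))"
    by (induction B rule: infinite_finite_induct) (simp_all add: abs_relatively_free_hom)
  finally show ?thesis
    by (intro that[of B c]) (use U(1) finU in \<open>auto simp: B_def abs_relatively_free_eq_iff\<close>)
qed

section \<open>The Grassmann identity in the generalized Grassmann algebra\<close>

lemma theta_mult_theta: "theta * (theta * x) = 2 * (x :: 'c::comm_ring_1 eps_ring)"
  using theta_square[where 'c = 'c] by (simp add: power2_eq_square flip: mult.assoc)

text \<open>
  Since \<open>\<theta>\<^sup>2 = 2\<close>, an element with \<open>\<alpha>\<^sup>2 = \<theta> \<alpha>\<close> satisfies \<open>(1 - \<theta> \<alpha>)\<^sup>2 = 1\<close>. The recursion below expresses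
  that the sign \<open>1 - \<theta> \<alpha>\<close> of a word is the product of the signs of its letters, while avoiding the
  division by \<open>\<theta>\<close>.
\<close>

fun eps_word :: "nat list \<Rightarrow> 'c::comm_ring_1 eps_ring" where
  "eps_word [] = 0"
| "eps_word (i # w) = eps i + eps_word w - theta * eps i * eps_word w"

text \<open>
  Where \<open>\<theta>\<close> is invertible, this says that \<open>\<alpha> / \<theta>\<close> is idempotent.
\<close>

abbreviation eps_idempotent :: "'c::comm_ring_1 eps_ring \<Rightarrow> bool" where
  "eps_idempotent \<alpha> \<equiv> \<alpha> * \<alpha> = theta * \<alpha>"

lemma eps_idempotent_mult:
  assumes "eps_idempotent \<alpha>" "eps_idempotent \<beta>"
  shows "\<alpha> * \<beta> * (\<alpha> * \<beta>) = 2 * (\<alpha> * \<beta>)"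
proof -
  have "\<alpha> * \<beta> * (\<alpha> * \<beta>) = (\<alpha> * \<alpha>) * (\<beta> * \<beta>)" by (simp add: algebra_simps)
  also have "\<dots> = theta * (theta * (\<alpha> * \<beta>))" unfolding assms by (simp add: algebra_simps)
  finally show ?thesis by (simp add: theta_mult_theta)
qed

lemma eps_idempotent_eps: "eps_idempotent (eps i)"
  using eps_square[of i] by (simp add: power2_eq_square)

lemma eps_idempotent_join:
  assumes "eps_idempotent \<alpha>" "eps_idempotent \<beta>"
  shows "eps_idempotent (\<alpha> + \<beta> - theta * \<alpha> * \<beta>)"
proof -
  have "(\<alpha> + \<beta> - theta * \<alpha> * \<beta>) * (\<alpha> + \<beta> - theta * \<alpha> * \<beta>)
      = \<alpha> * \<alpha> + \<beta> * \<beta> + 2 * (\<alpha> * \<beta>) + theta * (theta * ((\<alpha> * \<alpha>) * (\<beta> * \<beta>)))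
        - 2 * (theta * ((\<alpha> * \<alpha>) * \<beta>)) - 2 * (theta * (\<alpha> * (\<beta> * \<beta>)))"
    by (simp add: algebra_simps)
  also have "\<dots> = theta * (\<alpha> + \<beta> - theta * \<alpha> * \<beta>)"
  proof -
    have "theta * ((\<alpha> * \<alpha>) * \<beta>) = 2 * (\<alpha> * \<beta>)" "theta * (\<alpha> * (\<beta> * \<beta>)) = 2 * (\<alpha> * \<beta>)"
      unfolding assms using theta_mult_theta[of "\<alpha> * \<beta>"] by (simp_all add: ac_simps)
    moreover have "(\<alpha> * \<alpha>) * (\<beta> * \<beta>) = 2 * (\<alpha> * \<beta>)"
      unfolding assms using theta_mult_theta[of "\<alpha> * \<beta>"] by (simp add: ac_simps)
    ultimately show ?thesis
      using assms theta_mult_theta[of "\<alpha> * \<beta>"] by (simp add: theta_mult_theta algebra_simps)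
  qed
  finally show ?thesis .
qed

lemma eps_idempotent_word: "eps_idempotent (eps_word w)"
  by (induction w) (simp_all add: eps_idempotent_join eps_idempotent_eps)

definition skew_commute ::
  "'c::comm_ring_1 eps_ring \<Rightarrow> 'c eps_ring \<Rightarrow> 'c grassmann \<Rightarrow> 'c grassmann \<Rightarrow> bool" where
  "skew_commute \<alpha> \<beta> x y \<longleftrightarrow> commutator x y = eps_scale (\<alpha> * \<beta>) (x * y)"

lemma eps_scale_mult [simp]:
  "eps_scale c x * y = eps_scale c (x * y)" "x * eps_scale c y = eps_scale c (x * y)"
  by (rule eps_grassmann.scale_mult_left[symmetric] eps_grassmann.scale_mult_right[symmetric])+

lemma skew_commute_reversed_product:
  assumes "skew_commute \<alpha> \<beta> x y"
  shows "y * x = eps_scale (1 - \<alpha> * \<beta>) (x * y)"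
proof -
  have "y * x = x * y - commutator x y" by (simp add: commutator_def)
  thus ?thesis using assms by (simp add: skew_commute_def eps_grassmann.scale_left_diff_distrib)
qed

text \<open>
  From \<open>(\<alpha> \<beta>)\<^sup>2 = 2 \<alpha> \<beta>\<close> one gets \<open>\<alpha> \<beta> (1 - \<alpha> \<beta>) = - \<alpha> \<beta>\<close>, which accounts for the sign of the reversed
  commutator.
\<close>

lemma skew_commute_sym:
  assumes "skew_commute \<alpha> \<beta> x y" "eps_idempotent \<alpha>" "eps_idempotent \<beta>"
  shows "skew_commute \<beta> \<alpha> y x"
proof -
  have "\<beta> * \<alpha> * (1 - \<alpha> * \<beta>) = - (\<alpha> * \<beta>)"
    using eps_idempotent_mult[OF assms(2,3)] by (simp add: algebra_simps)
  hence "eps_scale (\<beta> * \<alpha>) (y * x) = eps_scale (- (\<alpha> * \<beta>)) (x * y)"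
    unfolding skew_commute_reversed_product[OF assms(1)] by simp
  thus ?thesis
    using assms(1) by (simp add: skew_commute_def commutator_swap[of y x])
qed

text \<open>
  This is the product rule; the correction \<open>- \<theta> \<alpha> \<beta>\<close> comes from bringing \<open>x z y\<close> into the order
  \<open>x y z\<close>.
\<close>

lemma skew_commute_mult:
  assumes "skew_commute \<alpha> \<gamma> x z" "skew_commute \<beta> \<gamma> y z" "eps_idempotent \<gamma>"
  shows "skew_commute (\<alpha> + \<beta> - theta * \<alpha> * \<beta>) \<gamma> (x * y) z"
proof -
  have "commutator (x * y) z = x * eps_scale (\<beta> * \<gamma>) (y * z) + eps_scale (\<alpha> * \<gamma>) (x * z) * y"
    using assms(1,2) by (simp only: commutator_mult_left skew_commute_def)
  also have "\<dots> = eps_scale (\<beta> * \<gamma>) (x * y * z) + eps_scale (\<alpha> * \<gamma>) (x * (z * y))"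
    by (simp add: mult.assoc)
  also have "z * y = eps_scale (1 - \<beta> * \<gamma>) (y * z)"
    by (rule skew_commute_reversed_product[OF assms(2)])
  also have "eps_scale (\<beta> * \<gamma>) (x * y * z) + eps_scale (\<alpha> * \<gamma>) (x * eps_scale (1 - \<beta> * \<gamma>) (y * z))
      = eps_scale (\<beta> * \<gamma> + \<alpha> * \<gamma> * (1 - \<beta> * \<gamma>)) (x * y * z)"
    by (simp add: eps_grassmann.scale_left_distrib mult.assoc)
  also have "\<beta> * \<gamma> + \<alpha> * \<gamma> * (1 - \<beta> * \<gamma>) = \<beta> * \<gamma> + \<alpha> * \<gamma> - \<alpha> * \<beta> * (\<gamma> * \<gamma>)"
    by (simp add: algebra_simps)
  also have "\<dots> = (\<alpha> + \<beta> - theta * \<alpha> * \<beta>) * \<gamma>"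
    unfolding assms(3) by (simp add: algebra_simps)
  finally show ?thesis by (simp add: skew_commute_def)
qed

definition gr_word :: "nat list \<Rightarrow> 'c::comm_ring_1 grassmann" where
  "gr_word w = prod_list (map gr_gen w)"

lemma gr_word_simps [simp]:
  "gr_word [] = 1" "gr_word (i # w) = gr_gen i * gr_word w"
  "gr_word (v @ w) = gr_word v * gr_word w"
  by (simp_all add: gr_word_def)

text \<open>
  Rules for products apply to the left argument only, so the right one is first a generator and then,
  by symmetry, an arbitrary word.
\<close>

lemma skew_commute_words: "skew_commute (eps_word v) (eps_word w) (gr_word v)
    (gr_word w :: 'c::comm_ring_1 grassmann)"
proof -
  have one: "skew_commute 0 \<beta> 1 x" for \<beta> :: "'c::comm_ring_1 eps_ring" and x
    by (simp add: skew_commute_def commutator_def)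
  have gen: "skew_commute (eps_word v) (eps i) (gr_word v) (gr_gen i :: 'c grassmann)" for v i
  proof (induction v)
    case (Cons j v)
    have "skew_commute (eps j) (eps i) (gr_gen j) (gr_gen i :: 'c grassmann)"
      by (simp add: skew_commute_def commutator_gr_gen)
    from skew_commute_mult[OF this Cons eps_idempotent_eps] show ?case by simp
  qed (use one in simp)
  have "skew_commute (eps_word w) (eps_word v) (gr_word w) (gr_word v :: 'c grassmann)" for v w
  proof (induction w)
    case (Cons j w)
    have "skew_commute (eps j) (eps_word v) (gr_gen j) (gr_word v :: 'c grassmann)"
      by (rule skew_commute_sym[OF gen eps_idempotent_word eps_idempotent_eps])
    from skew_commute_mult[OF this Cons eps_idempotent_word] show ?case by simp
  qed (use one in simp)
  thus ?thesis .
qed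

text \<open>
  Everything is rewritten as a multiple of \<open>z x y\<close>. The factor turns out to be
  \<open>2 \<theta> \<alpha> \<beta> \<gamma> - \<theta>\<^sup>3 \<alpha> \<beta> \<gamma>\<close>, which is zero as \<open>\<theta>\<^sup>2 = 2\<close>.
\<close>

lemma skew_commute_double_commutator:
  assumes "skew_commute \<alpha> \<beta> x y" "skew_commute \<gamma> \<alpha> z x" "skew_commute \<gamma> \<beta> z y"
    and "eps_idempotent \<alpha>" "eps_idempotent \<beta>" "eps_idempotent \<gamma>"
  shows "commutator z (commutator x y) = 0"
proof -
  have scale: "commutator z (eps_scale c u) = eps_scale c (commutator z u)" for c u
    by (simp add: commutator_def eps_grassmann.scale_right_diff_distrib)
  have "commutator z (commutator x y)
      = eps_scale (\<alpha> * \<beta>) (x * commutator z y + commutator z x * y)"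
    using assms(1) by (simp add: skew_commute_def scale commutator_mult_right)
  also have "\<dots> = eps_scale (\<alpha> * \<beta>) (eps_scale (\<gamma> * \<beta>) (x * z * y) + eps_scale (\<gamma> * \<alpha>) (z * x * y))"
    using assms(2,3) by (simp add: skew_commute_def mult.assoc)
  also have "x * z = eps_scale (1 - \<gamma> * \<alpha>) (z * x)"
    by (rule skew_commute_reversed_product[OF assms(2)])
  also have "eps_scale (\<alpha> * \<beta>) (eps_scale (\<gamma> * \<beta>) (eps_scale (1 - \<gamma> * \<alpha>) (z * x) * y)
        + eps_scale (\<gamma> * \<alpha>) (z * x * y))
      = eps_scale (\<alpha> * \<beta> * (\<gamma> * \<beta> * (1 - \<gamma> * \<alpha>) + \<gamma> * \<alpha>)) (z * x * y)"
    by (simp add: eps_grassmann.scale_left_distrib eps_grassmann.scale_right_distrib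
        distrib_left mult.assoc)
  also have "\<alpha> * \<beta> * (\<gamma> * \<beta> * (1 - \<gamma> * \<alpha>) + \<gamma> * \<alpha>)
      = (\<alpha> * \<gamma>) * (\<beta> * \<beta>) - (\<beta> * \<beta>) * ((\<alpha> * \<alpha>) * (\<gamma> * \<gamma>)) + (\<alpha> * \<alpha>) * (\<beta> * \<gamma>)"
    by (simp add: algebra_simps)
  also have "\<dots> = 0"
    unfolding assms(4-6)
    using theta_mult_theta[of "\<alpha> * \<beta> * \<gamma> * theta"] by (simp add: algebra_simps)
  finally show ?thesis by simp
qed

lemma abs_grassmann_hom:
  "abs_grassmann (p + q) = abs_grassmann p + abs_grassmann q"
  "abs_grassmann (p * q) = abs_grassmann p * abs_grassmann q"
  "abs_grassmann 1 = 1"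
  "abs_grassmann 0 = 0"
  "abs_grassmann (smult c p) = eps_scale c (abs_grassmann p)"
  by (simp_all add: plus_grassmann.abs_eq times_grassmann.abs_eq one_grassmann.abs_eq
      zero_grassmann.abs_eq eps_scale.abs_eq)

lemma abs_grassmann_single: "abs_grassmann (single (Word w) c) = eps_scale c (gr_word w)"
proof -
  have "abs_grassmann (single (Word w) 1) = (gr_word w :: 'a grassmann)"
  proof (induction w)
    case Nil
    show ?case
      using abs_grassmann_hom(3) by (simp add: zero_word_def flip: single_one)
  next
    case (Cons i w)
    have "single (Word (i # w)) 1 = gvar i * single (Word w) (1 :: 'a eps_ring)"
      by (simp add: gvar_def mult_single plus_word_def)
    thus ?case using Cons by (simp add: abs_grassmann_hom gr_gen.abs_eq)
  qed
  moreover have "single (Word w) c = smult c (single (Word w) 1)"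
    by (simp add: smult_conv_mult mult_single)
  ultimately show ?thesis by (simp add: abs_grassmann_hom)
qed

lemma grassmann_induct [case_names zero word add]:
  assumes "P 0" "\<And>c w. P (eps_scale c (gr_word w))" "\<And>x y. P x \<Longrightarrow> P y \<Longrightarrow> P (x + y)"
  shows "P (x :: 'c::comm_ring_1 grassmann)"
proof (induction x rule: grassmann.abs_induct)
  case (1 p)
  show ?case
  proof (induction p rule: poly_mapping_induct)
    case (single k c)
    thus ?case using assms(2) by (cases k) (simp add: abs_grassmann_single)
  qed (simp_all add: abs_grassmann_hom assms(1,3))
qed

instance grassmann :: (comm_ring_1) grassmann_ring
proof
  fix x y z :: "'a grassmann"
  have add: "commutator (a + b) c = commutator a c + commutator b c"
    "commutator c (a + b) = commutator c a + commutator c b"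
    "commutator (eps_scale r a) b = eps_scale r (commutator a b)"
    "commutator a (eps_scale r b) = eps_scale r (commutator a b)"
    "commutator 0 a = 0" "commutator a 0 = 0" for a b c :: "'a grassmann" and r
    by (simp_all add: commutator_def algebra_simps eps_grassmann.scale_right_diff_distrib)
  have "commutator z (commutator x y) = 0"
  proof (induction x rule: grassmann_induct)
    case (word c w)
    show ?case
    proof (induction y rule: grassmann_induct)
      case (word d v)
      show ?case
      proof (induction z rule: grassmann_induct)
        case (word r u)
        have "commutator (gr_word u) (commutator (gr_word w) (gr_word v)) = (0 :: 'a grassmann)"
          by (rule skew_commute_double_commutator) (rule skew_commute_words eps_idempotent_word)+
        thus ?case by (simp add: add)
      qed (simp_all add: add eps_grassmann.scale_right_distrib)
    qed (simp_all add: add)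
  qed (simp_all add: add)
  thus "(x * y - y * x) * z = z * (x * y - y * x)"
    by (simp add: commutator_def[of z] commutator_def[of x y])
qed

text \<open>
  The word \<open>e\<^sub>i e\<^sub>i\<close> has the invariant \<open>2 \<epsilon>\<^sub>i - \<theta> \<epsilon>\<^sub>i\<^sup>2 = 0\<close>, hence commutes with all words.
\<close>

lemma gr_gen_square_central: "gr_gen i * gr_gen i * x = x * (gr_gen i * gr_gen i)"
proof (induction x rule: grassmann_induct)
  case (word c w)
  have "eps_word [i, i] = (0 :: 'a eps_ring)"
    by (simp add: mult.assoc eps_idempotent_eps theta_mult_theta)
  with skew_commute_words[of "[i, i]" w, where 'c = 'a]
  have "commutator (gr_word [i, i]) (gr_word w) = (0 :: 'a grassmann)"
    unfolding skew_commute_def by (simp only: mult_zero_left eps_grassmann.scale_zero_left)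
  thus ?case by (simp add: commutator_def)
qed (simp_all add: distrib_left distrib_right)

text \<open>
  This is the defining relation for \<open>[e\<^sub>i, e\<^sub>i]\<close>.
\<close>

lemma theta_eps_gr_gen_square: "eps_scale (theta * eps i) (gr_gen i * gr_gen i) = 0"
  using commutator_gr_gen[of i i] by (simp add: eps_idempotent_eps)

text \<open>
  Up to a factor in \<open>C[\<epsilon>]\<close> the first \<open>e\<^sub>i\<close> can be moved next to the second one.
\<close>

lemma theta_eps_gr_word_repeated:
  assumes "i \<in> set w"
  shows "eps_scale (theta * eps i) (gr_gen i * gr_word w) = (0 :: 'c::comm_ring_1 grassmann)"
proof -
  from assms obtain u v where w: "w = u @ i # v" by (meson split_list)
  have "skew_commute (eps_word u) (eps_word [i]) (gr_word u) (gr_word [i] :: 'c grassmann)"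
    by (rule skew_commute_words)
  hence "gr_gen i * gr_word u
      = eps_scale (1 - eps_word u * eps i) (gr_word u * gr_gen i :: 'c grassmann)"
    using skew_commute_reversed_product by fastforce
  hence "gr_gen i * gr_word w
      = eps_scale (1 - eps_word u * eps i) (gr_word u * (gr_gen i * gr_gen i) * gr_word v :: 'c grassmann)"
    by (simp add: w flip: mult.assoc)
  hence "eps_scale (theta * eps i) (gr_gen i * gr_word w)
      = eps_scale (1 - eps_word u * eps i)
          (gr_word u * eps_scale (theta * eps i) (gr_gen i * gr_gen i) * gr_word v :: 'c grassmann)"
    by (simp add: mult.commute)
  thus ?thesis by (simp add: theta_eps_gr_gen_square)
qed

section \<open>Coefficient functionals\<close>

definition eps_degree :: "(eps_var \<Rightarrow>\<^sub>0 nat) \<Rightarrow> nat" where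
  "eps_degree m = (\<Sum>v\<in>keys m. lookup m v)"

lemma eps_degree_add: "eps_degree (m + n) = eps_degree m + eps_degree n"
  unfolding eps_degree_def by (rule setsum_keys_plus_distrib) simp_all

lemma eps_degree_single [simp]: "eps_degree (single v k) = k"
  by (cases "k = 0") (simp_all add: eps_degree_def)

lemma keys_add_nat: "keys (m + n) = keys m \<union> keys (n :: 'a \<Rightarrow>\<^sub>0 nat)"
  by (auto simp: in_keys_iff lookup_add)

lemma card_le_eps_degree:
  assumes "Eps ` J \<subseteq> keys m"
  shows "card J \<le> eps_degree m"
proof -
  have "card J = card (Eps ` J)"
    by (simp add: card_image inj_on_def)
  also have "\<dots> \<le> card (keys m)"
    by (rule card_mono) (use assms in auto)
  also have "\<dots> \<le> eps_degree m"
    unfolding eps_degree_def card_eq_sum by (rule sum_mono) (simp add: in_keys_iff Suc_leI)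
  finally show ?thesis .
qed

text \<open>
  As \<open>\<epsilon>\<^sub>i\<^sup>n\<^sup>+\<^sup>1 = \<theta>\<^sup>n \<epsilon>\<^sub>i\<close>, a monomial in which exactly the \<open>\<epsilon>\<^sub>j\<close> with \<open>j \<in> J\<close> occur equals
  \<open>\<theta>\<^sup>d \<Prod>\<^sub>j \<epsilon>\<^sub>j\<close> in \<open>C[\<epsilon>]\<close>, where \<open>d\<close> is its degree minus \<open>|J|\<close>; for odd \<open>d\<close> this is
  \<open>2\<^sup>(\<^sup>d\<^sup>-\<^sup>1\<^sup>)\<^sup>/\<^sup>2 \<theta> \<Prod>\<^sub>j \<epsilon>\<^sub>j\<close>. The value is thus the coefficient of \<open>\<theta> \<Prod>\<^sub>j \<epsilon>\<^sub>j\<close>.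
\<close>

definition eps_coefficient_mon :: "nat set \<Rightarrow> (eps_var \<Rightarrow>\<^sub>0 nat) \<Rightarrow> 'c::comm_ring_1" where
  "eps_coefficient_mon J m =
     (if keys m - {Theta} = Eps ` J \<and> odd (eps_degree m - card J)
      then 2 ^ ((eps_degree m - card J) div 2) else 0)"

abbreviation eps_coefficient_poly :: "nat set \<Rightarrow> 'c::comm_ring_1 eps_poly \<Rightarrow> 'c" where
  "eps_coefficient_poly J \<equiv> linear_extension (*) (eps_coefficient_mon J)"

lemma module_mult: "module ((*) :: 'c::comm_ring_1 \<Rightarrow> 'c \<Rightarrow> 'c)"
  by standard (simp_all add: algebra_simps)

lemmas linear_extension_mult_simps =
  module.linear_extension_add[OF module_mult] module.linear_extension_diff[OF module_mult]
  module.linear_extension_0[OF module_mult] module.linear_extension_single[OF module_mult]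
  module.linear_extension_smult[OF module_mult] module.linear_extension_sum[OF module_mult]

text \<open>
  The relation \<open>\<theta>\<^sup>2 = 2\<close> changes the degree by two, which the power of \<open>2\<close> compensates; the two sides of
  \<open>\<epsilon>\<^sub>i\<^sup>2 = \<theta> \<epsilon>\<^sub>i\<close> have the same degree and involve the same \<open>\<epsilon>\<close>-variables.
\<close>

lemma eps_coefficient_poly_vanishes:
  assumes "p \<in> eps_ideal"
  shows "eps_coefficient_poly J p = (0 :: 'c::comm_ring_1)"
proof (rule vanishes_on_generated_ideal[of _ eps_relations])
  show "p \<in> two_sided_ideal smult hull eps_relations"
    using assms by (simp add: eps_ideal_def)
  fix k l :: "eps_var \<Rightarrow>\<^sub>0 nat" and c d :: 'c and r :: "'c eps_poly"
  assume r: "r \<in> eps_relations"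
  define m e where "m = k + l" and "e = c * d"
  have "single k c * r * single l d = single k c * single l d * r"
    by (simp only: mult.assoc mult.commute[of r])
  hence swap: "single k c * r * single l d = single m e * r"
    by (simp add: m_def e_def mult_single)
  have "eps_coefficient_poly J (single m e * r) = 0"
    using r unfolding eps_relations_def
  proof (elim insertE imageE)
    assume r: "r = pvar Theta ^ 2 - 2"
    have "single m e * r = single (m + single Theta 2) e - single m (2 * e)"
    proof -
      have "single m e * (2 :: 'c eps_poly) = single m (2 * e)"
        by (simp add: mult_single mult.commute flip: single_numeral)
      thus ?thesis
        by (simp add: r pvar_def power2_eq_square right_diff_distrib mult_single numeral_2_eq_2
            flip: single_add)
    qed
    moreover have "eps_coefficient_mon J (m + single Theta 2) = (2 * eps_coefficient_mon J m :: 'c)"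
    proof -
      have "keys (m + single Theta (2::nat)) - {Theta} = keys m - {Theta}"
        by (auto simp: keys_add_nat)
      moreover have "card J \<le> eps_degree m" if "keys m - {Theta} = Eps ` J"
        by (rule card_le_eps_degree) (use that in blast)
      ultimately show ?thesis
        by (cases "keys m - {Theta} = Eps ` J")
          (simp_all add: eps_coefficient_mon_def eps_degree_add Suc_diff_le del: even_diff_nat)
    qed
    ultimately show ?thesis
      by (simp add: linear_extension_mult_simps)
  next
    fix i assume r: "r = pvar (Eps i) ^ 2 - pvar Theta * pvar (Eps i)"
    have "single m e * r = single (m + single (Eps i) 2) e
        - single (m + single Theta 1 + single (Eps i) 1) e"
      by (simp add: r pvar_def power2_eq_square right_diff_distrib mult_single numeral_2_eq_2
          add.assoc flip: single_add)
    moreover have "eps_coefficient_mon J (m + single (Eps i) 2)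
        = (eps_coefficient_mon J (m + single Theta 1 + single (Eps i) 1) :: 'c)"
    proof -
      have "keys (m + single (Eps i) (2::nat)) - {Theta}
          = keys (m + single Theta 1 + single (Eps i) (1::nat)) - {Theta}"
        by (auto simp: keys_add_nat)
      thus ?thesis by (simp add: eps_coefficient_mon_def eps_degree_add)
    qed
    ultimately show ?thesis
      by (simp add: linear_extension_mult_simps)
  qed
  thus "eps_coefficient_poly J (single k c * r * single l d) = 0"
    by (simp add: swap)
qed (simp add: linear_extension_mult_simps)

definition eps_coefficient :: "nat set \<Rightarrow> 'c::comm_ring_1 eps_ring \<Rightarrow> 'c" where
  "eps_coefficient J z = eps_coefficient_poly J (rep_eps_ring z)"

lemma eps_coefficient_abs [simp]:
  "eps_coefficient J (abs_eps_ring p) = eps_coefficient_poly J (p :: 'c::comm_ring_1 eps_poly)"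
proof -
  have "rep_eps_ring (abs_eps_ring p) - p \<in> eps_ideal"
    using Quotient3_abs_rep[OF Quotient3_eps_ring, of "abs_eps_ring p"]
    by (simp add: eps_ring.abs_eq_iff)
  from eps_coefficient_poly_vanishes[OF this, of J] show ?thesis
    by (simp add: eps_coefficient_def linear_extension_mult_simps)
qed

lemma abs_eps_ring_hom:
  "abs_eps_ring p + abs_eps_ring q = abs_eps_ring (p + q)"
  "abs_eps_ring p * abs_eps_ring q = abs_eps_ring (p * q)"
  by (simp_all add: plus_eps_ring.abs_eq times_eps_ring.abs_eq)

lemma eps_coefficient_add:
  "eps_coefficient J (y + z) = eps_coefficient J y + eps_coefficient J z"
proof (induction y rule: eps_ring.abs_induct)
  case (1 p)
  show ?case
    by (induction z rule: eps_ring.abs_induct)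
      (simp add: abs_eps_ring_hom linear_extension_mult_simps)
qed

lemma eps_coefficient_0 [simp]: "eps_coefficient J 0 = 0"
  using eps_coefficient_add[of J 0 0] by simp

lemma eps_coefficient_const: "eps_coefficient J (eps_const c * z) = c * eps_coefficient J z"
proof (induction z rule: eps_ring.abs_induct)
  case (1 p)
  show ?case
    by (simp add: eps_const.abs_eq abs_eps_ring_hom linear_extension_mult_simps
        flip: smult_conv_mult)
qed

lemma eps_coefficient_eps_mult:
  assumes "i \<notin> J"
  shows "eps_coefficient J (eps i * z) = (0 :: 'c::comm_ring_1)"
proof (induction z rule: eps_ring.abs_induct)
  case (1 p)
  have "eps_coefficient_poly J (pvar (Eps i) * p) = 0"
  proof (induction p rule: poly_mapping_induct)
    case (single m c)
    have "Eps i \<in> keys (single (Eps i) 1 + m) - {Theta}" "Eps i \<notin> Eps ` J"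
      using assms by (auto simp: keys_add_nat)
    hence "keys (single (Eps i) 1 + m) - {Theta} \<noteq> Eps ` J" by blast
    thus ?case
      by (simp add: pvar_def mult_single linear_extension_mult_simps eps_coefficient_mon_def)
  qed (simp_all add: distrib_left linear_extension_mult_simps)
  thus ?case by (simp add: eps.abs_eq abs_eps_ring_hom)
qed

lemma eps_coefficient_theta_prod:
  assumes "distinct w"
  shows "eps_coefficient (set w) (theta * prod_list (map eps w)) = (1 :: 'c::comm_ring_1)"
proof -
  define m where "m = sum_list (map (\<lambda>j. single (Eps j) (1::nat)) w)"
  have abs: "prod_list (map eps w) = (abs_eps_ring (single m 1) :: 'c eps_ring)"
    unfolding m_def
    by (induction w) (simp_all add: eps.abs_eq abs_eps_ring_hom pvar_def mult_single
        one_eps_ring.abs_eq)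
  have keys: "keys m = Eps ` set w"
    unfolding m_def by (induction w) (simp_all add: keys_add_nat)
  have deg: "eps_degree m = length w"
    unfolding m_def by (induction w) (simp_all add: eps_degree_add, simp add: eps_degree_def)
  have "Theta \<notin> Eps ` set w" by auto
  hence "eps_coefficient_mon (set w) (single Theta 1 + m) = (1 :: 'c)"
    using distinct_card[OF assms]
    by (auto simp: eps_coefficient_mon_def keys_add_nat keys deg eps_degree_add)
  thus ?thesis
    by (simp add: abs theta.abs_eq abs_eps_ring_hom pvar_def mult_single linear_extension_mult_simps)
qed

text \<open>
  Sorting a word without repeated letters with the rule \<open>e\<^sub>j e\<^sub>i = (1 - \<epsilon>\<^sub>i \<epsilon>\<^sub>j) e\<^sub>i e\<^sub>j\<close> produces this
  factor.
\<close>

fun inversion_factor :: "nat list \<Rightarrow> 'c::comm_ring_1 eps_ring" where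
  "inversion_factor [] = 1"
| "inversion_factor (i # w) =
     prod_list (map (\<lambda>j. if j < i then 1 - eps i * eps j else 1) w) * inversion_factor w"

lemma eps_sign_square: "(1 - eps i * eps j) * (1 - eps i * eps j) = (1 :: 'c::comm_ring_1 eps_ring)"
proof -
  have "(1 - eps i * eps j) * (1 - eps i * eps j)
      = 1 - 2 * (eps i * eps j) + eps i * eps j * (eps i * eps j :: 'c eps_ring)"
    by (simp add: algebra_simps)
  thus ?thesis
    by (simp only: eps_idempotent_mult[OF eps_idempotent_eps eps_idempotent_eps]) simp
qed

text \<open>
  If the exchange removes an inversion rather than creating one, the rule is used backwards, as the
  factor \<open>1 - \<epsilon>\<^sub>i \<epsilon>\<^sub>j\<close> is its own inverse.
\<close>

lemma inversion_factor_swap: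
  assumes "i \<noteq> j"
  shows "inversion_factor (u @ j # i # v) = (1 - eps i * eps j) * inversion_factor (u @ i # j # v)"
proof (induction u)
  case Nil
  consider "i < j" | "j < i" using assms by linarith
  thus ?case
  proof cases
    case 1
    thus ?thesis by (simp add: ac_simps)
  next
    case 2
    have cancel: "(1 - eps i * eps j) * ((1 - eps i * eps j) * x) = x" for x :: "'a eps_ring"
      using eps_sign_square[of i j, where 'c = 'a] by (simp flip: mult.assoc)
    show ?thesis using 2 by (simp add: ac_simps) (simp add: cancel)
  qed
qed (simp add: ac_simps)

lemma inversion_factor_sorted: "sorted w \<Longrightarrow> inversion_factor w = 1"
proof (induction w)
  case (Cons i w)
  have "prod_list (map (\<lambda>j. if j < i then 1 - eps i * eps j else 1) w)
      = prod_list (map (\<lambda>j. 1 :: 'a eps_ring) w)"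
    using Cons.prems by (intro arg_cong[of _ _ prod_list] map_cong) auto
  also have "\<dots> = 1"
    by (induction w) simp_all
  finally show ?case using Cons by simp
qed simp

text \<open>
  Letters outside \<open>J\<close> may be ignored in the inversion factor: they would contribute terms with
  \<open>\<epsilon>\<^sub>i\<close>, \<open>i \<notin> J\<close>, to which \<open>eps_coefficient J\<close> is blind.
\<close>

definition word_coefficient ::
  "nat set \<Rightarrow> nat multiset \<Rightarrow> nat word \<Rightarrow> 'c::comm_ring_1 eps_ring" where
  "word_coefficient J \<mu> w =
     (if mset (letters w) = \<mu> then inversion_factor (filter (\<lambda>i. i \<in> J) (letters w)) else 0)"

definition gr_coefficient_poly ::
  "nat set \<Rightarrow> nat multiset \<Rightarrow> 'c::comm_ring_1 gr_poly \<Rightarrow> 'c" where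
  "gr_coefficient_poly J \<mu> p = eps_coefficient J (linear_extension (*) (word_coefficient J \<mu>) p)"

text \<open>
  A relation between \<open>e\<^sub>i\<close> and \<open>e\<^sub>j\<close> is respected by the inversion factor if \<open>i\<close> and \<open>j\<close> are distinct
  elements of \<open>J\<close>, because of \<open>eps_coefficient J\<close> if one of them lies outside \<open>J\<close>, and because of the
  multiplicities in \<open>\<mu>\<close> if they are equal.
\<close>

lemma gr_coefficient_poly_vanishes:
  assumes p: "p \<in> grassmann_ideal" and \<mu>: "\<And>j. j \<in> J \<Longrightarrow> count \<mu> j \<le> 1"
  shows "gr_coefficient_poly J \<mu> p = (0 :: 'c::comm_ring_1)"
proof (rule vanishes_on_generated_ideal[of _ grassmann_relations])
  show "p \<in> two_sided_ideal smult hull grassmann_relations"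
    using p by (simp add: grassmann_ideal_def)
  fix k l :: "nat word" and c d :: "'c eps_ring" and r :: "'c gr_poly"
  assume "r \<in> grassmann_relations"
  then obtain i j where
    r: "r = commutator (gvar i) (gvar j) - smult (eps i * eps j) (gvar i * gvar j)"
    by (auto simp: grassmann_relations_def)
  let ?ij = "k + Word [i, j] + l" and ?ji = "k + Word [j, i] + l"
  let ?\<phi> = "word_coefficient J \<mu> :: nat word \<Rightarrow> 'c eps_ring"
  have "single k c * r * single l d
      = single ?ij (c * d) - single ?ji (c * d) - single ?ij (c * d * (eps i * eps j))"
    unfolding r commutator_def gvar_def smult_conv_mult
    by (simp add: left_diff_distrib right_diff_distrib mult_single ac_simps)
      (simp add: plus_word_def ac_simps)
  note expand = this
  have eq: "gr_coefficient_poly J \<mu> (single k c * r * single l d)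
      = eps_coefficient J (c * d * (?\<phi> ?ij - ?\<phi> ?ji - eps i * eps j * ?\<phi> ?ij))"
    unfolding expand by (simp add: gr_coefficient_poly_def linear_extension_mult_simps algebra_simps)
  have mset: "mset (letters ?ij) = mset (letters ?ji)"
    by (simp add: plus_word_def)
  consider "i \<notin> J \<or> j \<notin> J" | "i \<in> J" "i = j" | "i \<in> J" "j \<in> J" "i \<noteq> j" by blast
  thus "gr_coefficient_poly J \<mu> (single k c * r * single l d) = 0"
  proof cases
    case 1
    hence "?\<phi> ?ij = ?\<phi> ?ji"
      using mset by (auto simp: word_coefficient_def plus_word_def)
    hence "c * d * (?\<phi> ?ij - ?\<phi> ?ji - eps i * eps j * ?\<phi> ?ij)
        = eps i * (eps j * (- c * d * ?\<phi> ?ij))"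
      "eps i * (eps j * (- c * d * ?\<phi> ?ij)) = eps j * (eps i * (- c * d * ?\<phi> ?ij))"
      by (simp_all add: ac_simps)
    with 1 show ?thesis unfolding eq by (metis eps_coefficient_eps_mult)
  next
    case 2
    have "count (mset (letters ?ij)) i \<ge> 2"
      using 2 by (simp add: plus_word_def)
    hence "?\<phi> ?ij = 0" "?\<phi> ?ji = 0"
      using \<mu>[OF 2(1)] mset by (auto simp: word_coefficient_def)
    thus ?thesis unfolding eq by simp
  next
    case 3
    have "?\<phi> ?ji = (1 - eps i * eps j) * ?\<phi> ?ij"
      using mset inversion_factor_swap[OF 3(3)] 3(1,2)
      by (auto simp: word_coefficient_def plus_word_def)
    hence "?\<phi> ?ij - ?\<phi> ?ji - eps i * eps j * ?\<phi> ?ij = 0"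
      by (simp add: algebra_simps)
    thus ?thesis unfolding eq by simp
  qed
qed (simp add: gr_coefficient_poly_def linear_extension_mult_simps eps_coefficient_add)

text \<open>
  Given a word \<open>u s\<close>, the functional for the multiset of its letters picks out \<open>c s\<close>: the other words
  have different letters, and the subword of letters from \<open>w\<close> is sorted, so there is no inversion.
\<close>

lemma gr_words_independent:
  fixes c :: "'s \<Rightarrow> 'c::comm_ring_1" and u :: "'s \<Rightarrow> nat list"
  assumes S: "finite S" "s \<in> S"
    and w: "sorted w" "distinct w"
    and filter: "\<And>s. s \<in> S \<Longrightarrow> filter (\<lambda>i. i \<in> set w) (u s) = w"
    and inj: "\<And>t. t \<in> S \<Longrightarrow> mset (u t) = mset (u s) \<Longrightarrow> t = s"
    and zero: "(\<Sum>s\<in>S. eps_scale (eps_const (c s) * (theta * prod_list (map eps w))) (gr_word (u s))) = 0"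
  shows "c s = 0"
proof -
  let ?E = "theta * prod_list (map eps w) :: 'c eps_ring"
  define p where "p = (\<Sum>s\<in>S. single (Word (u s)) (eps_const (c s) * ?E))"
  let ?\<mu> = "mset (u s)"
  have "abs_grassmann p = 0"
    unfolding p_def zero[symmetric]
    by (induction S rule: infinite_finite_induct)
      (simp_all add: abs_grassmann_hom abs_grassmann_single)
  hence "p \<in> grassmann_ideal"
    unfolding zero_grassmann_def by (simp add: grassmann.abs_eq_iff)
  moreover have "count ?\<mu> j \<le> 1" if "j \<in> set w" for j
  proof -
    have "count ?\<mu> j = count (mset (filter (\<lambda>i. i \<in> set w) (u s))) j"
      using that by simp
    also have "\<dots> \<le> 1"
      using w(2) by (simp add: filter S(2) distinct_count_atmost_1)
    finally show ?thesis .
  qed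
  ultimately have "gr_coefficient_poly (set w) ?\<mu> p = 0"
    by (rule gr_coefficient_poly_vanishes)
  also have "gr_coefficient_poly (set w) ?\<mu> p
      = eps_coefficient (set w) (\<Sum>t\<in>S. eps_const (c t) * ?E * word_coefficient (set w) ?\<mu> (Word (u t)))"
    by (simp add: gr_coefficient_poly_def p_def linear_extension_mult_simps)
  also have "(\<Sum>t\<in>S. eps_const (c t) * ?E * word_coefficient (set w) ?\<mu> (Word (u t)))
      = (\<Sum>t\<in>S. if t = s then eps_const (c s) * ?E else 0)"
    by (rule sum.cong) (use inj in \<open>auto simp: word_coefficient_def filter S(2) inversion_factor_sorted w\<close>)
  also have "\<dots> = eps_const (c s) * ?E"
    using S by simp
  finally show ?thesis
    by (simp add: eps_coefficient_const eps_coefficient_theta_prod w)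
qed

section \<open>Evaluation at generic elements\<close>

definition odd_word :: "nat list \<Rightarrow> nat list" where
  "odd_word k = map (\<lambda>j. 2 * j + 1) k"

definition square_word :: "nat list \<Rightarrow> nat list" where
  "square_word s = concat (map (\<lambda>i. [2 * i, 2 * i]) s)"

text \<open>
  The central squares \<open>e\<^sub>2\<^sub>i\<^sup>2\<close> serve as polynomial variables that record the ordinary letters of a normal
  monomial, whereas the generators \<open>e\<^sub>2\<^sub>i\<^sub>+\<^sub>1\<close> detect its commutators.
\<close>

definition generic_element :: "nat set \<Rightarrow> nat \<Rightarrow> 'c::comm_ring_1 grassmann" where
  "generic_element J i =
     gr_gen (2 * i) * gr_gen (2 * i) + (if i \<in> J then gr_gen (2 * i + 1) else 0)"

lemma commutator_generic_element:
  "commutator (generic_element J i) (generic_element J j) =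
     (if i \<in> J \<and> j \<in> J then commutator (gr_gen (2 * i + 1)) (gr_gen (2 * j + 1)) else 0)"
proof -
  have central: "commutator (gr_gen l * gr_gen l) x = 0" "commutator x (gr_gen l * gr_gen l) = 0"
    for l and x :: "'a grassmann"
    by (simp_all add: commutator_def gr_gen_square_central)
  have "commutator (x + y) z = commutator x z + commutator y z"
    "commutator z (x + y) = commutator z x + commutator z y"
    "commutator 0 z = 0" "commutator z 0 = 0" for x y z :: "'a grassmann"
    by (simp_all add: commutator_def algebra_simps)
  thus ?thesis by (simp add: generic_element_def central)
qed

lemma commutator_prod_generic_outside:
  assumes "even (length k)" "\<not> set k \<subseteq> J"
  shows "commutator_prod (map (generic_element J) k) = (0 :: 'c::comm_ring_1 grassmann)"
  using assms
  by (induction k rule: induct_list012) (auto simp: commutator_generic_element)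

lemma commutator_prod_generic_inside:
  assumes "even (length k)" "set k \<subseteq> J"
  shows "commutator_prod (map (generic_element J) k) =
    eps_scale (prod_list (map eps (odd_word k))) (gr_word (odd_word k) :: 'c::comm_ring_1 grassmann)"
  using assms
  by (induction k rule: induct_list012)
    (auto simp: commutator_generic_element commutator_gr_gen odd_word_def ac_simps)

text \<open>
  The product \<open>X\<close> of commutators is central. A generator \<open>e\<^sub>2\<^sub>i\<^sub>+\<^sub>1\<close> with \<open>i\<close> in \<open>k\<close> already occurs in it and
  thus annihilates it, by \<open>theta_eps_gr_word_repeated\<close>; so each remaining factor acts on \<open>X\<close> as the
  central square alone.
\<close>

lemma generic_normal_product:
  assumes "even (length k)"
  defines "X \<equiv> eps_scale (theta * prod_list (map eps (odd_word k))) (gr_word (odd_word k))"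
  shows "eps_scale theta (normal_product (generic_element (set k)) (s, k)) =
    gr_word (square_word s) * (X :: 'c::comm_ring_1 grassmann)"
proof -
  have X: "X = eps_scale theta (commutator_prod (map (generic_element (set k)) k))"
    using commutator_prod_generic_inside[OF assms(1), of "set k", where 'c = 'c] by (simp add: X_def)
  have central: "X * y = y * X" for y
    unfolding X by (simp add: commutator_prod_central)
  have absorb: "generic_element (set k) i * X = gr_gen (2 * i) * gr_gen (2 * i) * X" for i
  proof -
    have "gr_gen (2 * i + 1) * X = 0" if i: "i \<in> set k"
    proof -
      have mem: "2 * i + 1 \<in> set (odd_word k)"
        using i by (auto simp: odd_word_def)
      obtain u v where "odd_word k = u @ (2 * i + 1) # v"
        using split_list[OF mem] by blast
      then obtain c where c: "prod_list (map eps (odd_word k)) = (eps (2 * i + 1) * c :: 'c eps_ring)"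
        by (intro that[of "prod_list (map eps u) * prod_list (map eps v)"]) (simp add: ac_simps)
      have "gr_gen (2 * i + 1) * X
          = eps_scale c (eps_scale (theta * eps (2 * i + 1)) (gr_gen (2 * i + 1) * gr_word (odd_word k)))"
        unfolding X_def c by (simp add: ac_simps)
      thus ?thesis by (simp only: theta_eps_gr_word_repeated[OF mem] eps_grassmann.scale_zero_right)
    qed
    thus ?thesis by (simp add: generic_element_def distrib_right)
  qed
  have "prod_list (map (generic_element (set k)) s) * X = gr_word (square_word s) * X"
  proof (induction s)
    case (Cons i s)
    have "prod_list (map (generic_element (set k)) (i # s)) * X
        = generic_element (set k) i * X * gr_word (square_word s)"
      by (simp add: mult.assoc Cons central)
    thus ?case
      by (simp add: absorb mult.assoc central square_word_def)
  qed (simp add: square_word_def)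
  thus ?thesis by (simp add: X normal_product_def)
qed

lemma sorted_odd_word: "sorted k \<Longrightarrow> sorted (odd_word k)"
  by (auto simp: odd_word_def sorted_map intro: sorted_wrt_mono_rel)

lemma distinct_odd_word: "distinct k \<Longrightarrow> distinct (odd_word k)"
  by (auto simp: odd_word_def distinct_map inj_on_def)

lemma filter_square_odd_word:
  "filter (\<lambda>i. i \<in> set (odd_word k)) (square_word s @ odd_word k) = odd_word k"
proof -
  have "filter (\<lambda>i. i \<in> set (odd_word k)) (square_word s) = []"
    by (auto simp: filter_empty_conv odd_word_def square_word_def) presburger
  thus ?thesis by (simp add: filter_id_conv)
qed

lemma square_word_inj:
  assumes "sorted s" "sorted t"
    and "mset (square_word s @ odd_word k) = mset (square_word t @ odd_word k)"
  shows "s = t"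
proof -
  have count: "count (mset (square_word s)) (2 * i) = 2 * count (mset s) i" for s i
    by (induction s) (auto simp: square_word_def)
  have "count (mset s) i = count (mset t) i" for i
    using assms(3) count[of s i] count[of t i] by simp
  hence "mset s = mset t" by (simp add: multiset_eq_iff)
  thus ?thesis using assms(1,2) by (metis properties_for_sort)
qed

section \<open>The identities of the generalized Grassmann algebra\<close>

text \<open>
  Evaluate at the generic elements for a shortest commutator part \<open>k\<close>. Any other \<open>l\<close> that occurs is at
  least as long, hence has an entry outside \<open>k\<close>, whose generic element is central.
\<close>

lemma normal_combination_identity_trivial:
  fixes c :: "nat list \<times> nat list \<Rightarrow> 'c::comm_ring_1"
  assumes B: "finite B" "B \<subseteq> normal_indices" and c: "\<And>b. b \<in> B \<Longrightarrow> c b \<noteq> 0"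
    and zero: "\<And>a :: nat \<Rightarrow> 'c grassmann. (\<Sum>b\<in>B. gr_scale (c b) (normal_product a b)) = 0"
  shows "B = {}"
proof (rule ccontr)
  assume "B \<noteq> {}"
  then obtain s0 k where sk: "(s0, k) \<in> B" and min: "\<And>b. b \<in> B \<Longrightarrow> length k \<le> length (snd b)"
    using ex_has_least_nat[of "\<lambda>b. b \<in> B" _ "\<lambda>b. length (snd b)"] by (metis all_not_in_conv snd_conv surj_pair)
  have k: "sorted k" "distinct k" "even (length k)"
    using sk B(2) by (auto simp: normal_indices_def)
  define S where "S = {s. (s, k) \<in> B}"
  let ?a = "generic_element (set k) :: nat \<Rightarrow> 'c grassmann"
  let ?E = "theta * prod_list (map eps (odd_word k)) :: 'c eps_ring"
  have other: "normal_product ?a (s, l) = 0" if "(s, l) \<in> B" "l \<noteq> k" for s l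
  proof -
    have l: "sorted l" "distinct l" "even (length l)"
      using that(1) B(2) by (auto simp: normal_indices_def)
    have "\<not> set l \<subseteq> set k"
    proof
      assume "set l \<subseteq> set k"
      moreover have "card (set k) \<le> card (set l)"
        using min[OF that(1)] k(2) l(2) by (simp add: distinct_card)
      ultimately have "set l = set k"
        by (simp add: card_seteq)
      with that(2) k l show False
        by (metis sorted_distinct_set_unique)
    qed
    thus ?thesis
      using commutator_prod_generic_outside[OF l(3), where 'c = 'c] by (simp add: normal_product_def)
  qed
  have "0 = eps_scale theta (\<Sum>b\<in>B. gr_scale (c b) (normal_product ?a b))"
    by (simp add: zero)
  also have "(\<Sum>b\<in>B. gr_scale (c b) (normal_product ?a b))
      = (\<Sum>b\<in>(\<lambda>s. (s, k)) ` S. gr_scale (c b) (normal_product ?a b))"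
  proof (rule sum.mono_neutral_right)
    show "\<forall>b\<in>B - (\<lambda>s. (s, k)) ` S. gr_scale (c b) (normal_product ?a b) = 0"
    proof safe
      fix s l assume "(s, l) \<in> B" "(s, l) \<notin> (\<lambda>s. (s, k)) ` S"
      moreover from this have "l \<noteq> k" by (auto simp: S_def)
      ultimately show "gr_scale (c (s, l)) (normal_product ?a (s, l)) = 0"
        by (simp add: other)
    qed
  qed (use B(1) in \<open>auto simp: S_def\<close>)
  also have "\<dots> = (\<Sum>s\<in>S. gr_scale (c (s, k)) (normal_product ?a (s, k)))"
    by (subst sum.reindex) (auto simp: inj_on_def)
  also have "eps_scale theta \<dots>
      = (\<Sum>s\<in>S. eps_scale (eps_const (c (s, k))) (eps_scale theta (normal_product ?a (s, k))))"
    by (simp add: eps_grassmann.scale_sum_right gr_scale_def mult.commute)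
  also have "\<dots> = (\<Sum>s\<in>S. eps_scale (eps_const (c (s, k)) * ?E) (gr_word (square_word s @ odd_word k)))"
    unfolding generic_normal_product[OF k(3)] by simp
  finally have sum0: "(\<Sum>s\<in>S. eps_scale (eps_const (c (s, k)) * ?E)
      (gr_word (square_word s @ odd_word k))) = 0" ..
  have "c (s0, k) = 0"
  proof (rule gr_words_independent[where S = S and s = s0 and w = "odd_word k"
        and u = "\<lambda>s. square_word s @ odd_word k" and c = "\<lambda>s. c (s, k)"])
    have "S \<subseteq> fst ` B" by (force simp: S_def)
    thus "finite S" using B(1) finite_surj by blast
    show "s0 \<in> S" using sk by (simp add: S_def)
    show "t = s0" if "t \<in> S" "mset (square_word t @ odd_word k) = mset (square_word s0 @ odd_word k)" for t
      by (rule square_word_inj[OF _ _ that(2)])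
        (use that(1) sk B(2) in \<open>auto simp: S_def normal_indices_def\<close>)
  qed (use sum0 k in \<open>simp_all only: sorted_odd_word distinct_odd_word filter_square_odd_word\<close>)
  with c[OF sk] show False by simp
qed

lemma grassmann_T_ideal_subset_identities:
  "grassmann_T_ideal \<subseteq> identities (gr_scale :: 'c::comm_ring_1 \<Rightarrow> 'c grassmann \<Rightarrow> _)"
  unfolding grassmann_T_ideal_def
proof (rule hull_minimal)
  show "T_ideal (identities (gr_scale :: 'c \<Rightarrow> 'c grassmann \<Rightarrow> _))"
    by (rule T_ideal_identities) (rule grassmann.assoc_algebra_axioms)
  have "evaluate gr_scale a (commutator (letter 0) (commutator (letter 1) (letter 2)))
      = commutator (a 0) (commutator (a 1) (a 2))" for a :: "nat \<Rightarrow> 'c grassmann"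
  proof -
    have hom: "algebra_hom fsmult gr_scale (evaluate gr_scale a)"
      by (rule algebra_hom_evaluate_unital) (rule grassmann.assoc_algebra_axioms)
    have "evaluate gr_scale a (commutator f g)
        = commutator (evaluate gr_scale a f) (evaluate gr_scale a g)" for f g
      using hom module_hom.diff[of fsmult gr_scale "evaluate gr_scale a"]
      by (simp add: algebra_hom_def commutator_def)
    thus ?thesis by (simp add: evaluate_letter grassmann.module_axioms)
  qed
  moreover have "commutator x (commutator y z) = 0" for x y z :: "'c grassmann"
    by (simp add: commutator_def[of x] commutator_central)
  ultimately show "{commutator (letter 0) (commutator (letter 1) (letter 2))}
      \<subseteq> identities (gr_scale :: 'c \<Rightarrow> 'c grassmann \<Rightarrow> _)"
    by (simp add: identities_def)
qed

text \<open>
  An identity is congruent modulo the T-ideal to a combination of normal monomials. That combination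
  is an identity as well, hence trivial.
\<close>

lemma identities_subset_grassmann_T_ideal:
  "identities (gr_scale :: 'c::comm_ring_1 \<Rightarrow> 'c grassmann \<Rightarrow> _) \<subseteq> grassmann_T_ideal"
proof
  fix f assume f: "f \<in> identities (gr_scale :: 'c \<Rightarrow> 'c grassmann \<Rightarrow> _)"
  let ?X = "\<lambda>n. single (Word [n]) 1 :: nat word \<Rightarrow>\<^sub>0 'c"
  obtain B c where B: "finite B" "B \<subseteq> normal_indices" and c: "\<And>b. b \<in> B \<Longrightarrow> c b \<noteq> 0"
    and diff: "ncpoly f - (\<Sum>b\<in>B. smult (c b) (normal_product ?X b)) \<in> unital_T_ideal"
    using normal_form_modulo_T_ideal[of "ncpoly f"] by blast
  have vanish: "(\<Sum>b\<in>B. gr_scale (c b) (normal_product a b)) = 0" for a :: "nat \<Rightarrow> 'c grassmann"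
  proof -
    note linear = unital_evaluate_linear[OF grassmann.module_axioms]
    let ?ev = "unital_evaluate gr_scale a"
    obtain t where t: "t \<in> grassmann_T_ideal"
      "ncpoly f - (\<Sum>b\<in>B. smult (c b) (normal_product ?X b)) = ncpoly t"
      using diff by (auto simp: unital_T_ideal_def)
    have "?ev (ncpoly t) = 0" "?ev (ncpoly f) = 0"
      using f t(1) grassmann_T_ideal_subset_identities
      by (auto simp: identities_def evaluate_eq_unital_evaluate)
    hence "?ev (\<Sum>b\<in>B. smult (c b) (normal_product ?X b)) = 0"
      unfolding t(2)[symmetric] linear by simp
    moreover have "?ev (normal_product ?X b) = normal_product a b" for b
    proof -
      have "?ev (normal_product ?X b) = normal_product (\<lambda>n. ?ev (?X n)) b"
        by (rule normal_product_hom)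
          (simp_all add: linear unital_evaluate_mult grassmann.assoc_algebra_axioms
            unital_evaluate_one grassmann.module_axioms)
      thus ?thesis
        by (simp add: unital_evaluate_word grassmann.module_axioms)
    qed
    ultimately show ?thesis by (simp add: linear)
  qed
  have "B = {}"
    using B c vanish by (rule normal_combination_identity_trivial)
  with diff show "f \<in> grassmann_T_ideal"
    by (auto simp: unital_T_ideal_def ncpoly_inject)
qed

theorem theorem2p4:
  shows "identities (gr_scale :: 'c::comm_ring_1 \<Rightarrow> 'c grassmann \<Rightarrow> 'c grassmann) =
    T_ideal hull {commutator (letter 0) (commutator (letter 1) (letter 2))}"
  using grassmann_T_ideal_subset_identities identities_subset_grassmann_T_ideal
  unfolding grassmann_T_ideal_def by blast

end
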